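(* Let $M$ be a $C^\infty$ manifold and let $P\in\Gamma\wedge^3TM$ be a $3$-vector field on $M$. Then $P$ defines a ternary Poisson bracket on $M$ if and only if, around every point $x\in M$, $P$ is decomposable (that is, every $x\in M$ has a neighbourhood $U$ such that $P_y\in\wedge^3T_yM$ is decomposable for every $y\in U$).
   Context: Everything is in the $C^\infty$ category. Given $P\in\Gamma\wedge^3TM$, put $\{f_1,f_2,f_3\}=P(df_1,df_2,df_3)$ for $f_1,f_2,f_3\in C^\infty(M)$. One says that $P$ defines a ternary Poisson bracket if the generalized Jacobi identity of order $3$ holds: $$\sum_{\sigma\in S_{5}}(\mathrm{sign}\,\sigma)\,\{\{f_{\sigma_{1}},f_{\sigma_{2}},f_{\sigma_{3}}\},f_{\sigma_{4}},f_{\sigma_{5}}\}=0$$ for all $f_1,\dots,f_5\in C^\infty(M)$. For a vector space $L$, an element $Q\in\wedge^3L$ is decomposable if there are $W_1,W_2,W_3\in L$ with $Q=W_1\wedge W_2\wedge W_3$; in particular $Q=0$ is decomposable. *)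

theory Defs
  imports "HOL-Analysis.Analysis" "HOL-Library.Function_Algebras"
    "HOL-Combinatorics.Permutations"
begin

section \<open>Alternating trivectors of a vector space\<close>

instantiation "fun" :: (type, real_vector) real_vector
begin

definition scaleR_fun :: "real \<Rightarrow> ('a \<Rightarrow> 'b) \<Rightarrow> 'a \<Rightarrow> 'b"
  where "scaleR_fun r f = (\<lambda>x. r *\<^sub>R f x)"

instance
  by standard (auto simp: scaleR_fun_def plus_fun_def fun_eq_iff scaleR_add_right scaleR_add_left)

end

lemma scaleR_fun_apply [simp]: "(r *\<^sub>R f) x = r *\<^sub>R f x"
  by (simp add: scaleR_fun_def)

text \<open>
  In this section \<open>L\<close> is meant to be a linear subspace of its ambient type. Functions on \<open>L\<close>
  are made unique by requiring them to vanish off \<open>L\<close>.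
\<close>

definition dual_space :: "'v::real_vector set \<Rightarrow> ('v \<Rightarrow> real) set"
  where "dual_space L = {\<alpha>.
    (\<forall>v. v \<notin> L \<longrightarrow> \<alpha> v = 0) \<and>
    (\<forall>v\<in>L. \<forall>w\<in>L. \<alpha> (v + w) = \<alpha> v + \<alpha> w) \<and>
    (\<forall>r. \<forall>v\<in>L. \<alpha> (r *\<^sub>R v) = r * \<alpha> v)}"

type_synonym 'v trivector = "('v \<Rightarrow> real) \<Rightarrow> ('v \<Rightarrow> real) \<Rightarrow> ('v \<Rightarrow> real) \<Rightarrow> real"

text \<open>
  For finite-dimensional \<open>L\<close>, the third exterior power of \<open>L\<close> is realised as the space of
  alternating trilinear forms on the dual of \<open>L\<close>. Linearity in the other two arguments follows
  from linearity in the first one and the antisymmetry.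
\<close>

definition exterior_cube :: "'v::real_vector set \<Rightarrow> 'v trivector set"
  where "exterior_cube L = {Q.
    (\<forall>\<alpha> \<beta> \<gamma>. \<not> (\<alpha> \<in> dual_space L \<and> \<beta> \<in> dual_space L \<and> \<gamma> \<in> dual_space L) \<longrightarrow> Q \<alpha> \<beta> \<gamma> = 0) \<and>
    (\<forall>\<alpha>\<in>dual_space L. \<forall>\<alpha>'\<in>dual_space L. \<forall>\<beta>\<in>dual_space L. \<forall>\<gamma>\<in>dual_space L.
       Q (\<alpha> + \<alpha>') \<beta> \<gamma> = Q \<alpha> \<beta> \<gamma> + Q \<alpha>' \<beta> \<gamma>) \<and>
    (\<forall>r. \<forall>\<alpha>\<in>dual_space L. \<forall>\<beta>\<in>dual_space L. \<forall>\<gamma>\<in>dual_space L.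
       Q (r *\<^sub>R \<alpha>) \<beta> \<gamma> = r * Q \<alpha> \<beta> \<gamma>) \<and>
    (\<forall>\<alpha>\<in>dual_space L. \<forall>\<beta>\<in>dual_space L. \<forall>\<gamma>\<in>dual_space L.
       Q \<beta> \<alpha> \<gamma> = - Q \<alpha> \<beta> \<gamma> \<and> Q \<alpha> \<gamma> \<beta> = - Q \<alpha> \<beta> \<gamma>)}"

definition wedge3 :: "'v::real_vector set \<Rightarrow> 'v \<Rightarrow> 'v \<Rightarrow> 'v \<Rightarrow> 'v trivector"
  where "wedge3 L u v w = (\<lambda>\<alpha> \<beta> \<gamma>.
    if \<alpha> \<in> dual_space L \<and> \<beta> \<in> dual_space L \<and> \<gamma> \<in> dual_space L
    then det (vector [vector [\<alpha> u, \<alpha> v, \<alpha> w],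
                      vector [\<beta> u, \<beta> v, \<beta> w],
                      vector [\<gamma> u, \<gamma> v, \<gamma> w]] :: real^3^3)
    else 0)"

definition decomposable3 :: "'v::real_vector set \<Rightarrow> 'v trivector \<Rightarrow> bool"
  where "decomposable3 L Q \<longleftrightarrow> (\<exists>u\<in>L. \<exists>v\<in>L. \<exists>w\<in>L. Q = wedge3 L u v w)"

lemma dual_space_add: "subspace L \<Longrightarrow> \<alpha> \<in> dual_space L \<Longrightarrow> \<beta> \<in> dual_space L \<Longrightarrow> \<alpha> + \<beta> \<in> dual_space L"
  by (auto simp: dual_space_def algebra_simps)

lemma dual_space_scaleR: "subspace L \<Longrightarrow> \<alpha> \<in> dual_space L \<Longrightarrow> r *\<^sub>R \<alpha> \<in> dual_space L"
  by (auto simp: dual_space_def subspace_scale subspace_add algebra_simps)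

lemma wedge3_in_exterior_cube:
  assumes "subspace L"
  shows "wedge3 L u v w \<in> exterior_cube L"
  unfolding exterior_cube_def wedge3_def
  by (auto simp: dual_space_add[OF assms] dual_space_scaleR[OF assms] det_3 vector_3
      algebra_simps)


section \<open>Smooth maps and smooth manifolds\<close>

text \<open>Only meant for open \<open>S\<close> and finite-dimensional domains: all iterated directional
  derivatives exist as Frechet derivatives applied to fixed vectors, and are continuous.\<close>

primrec Ck_on :: "nat \<Rightarrow> 'e::real_normed_vector set \<Rightarrow> ('e \<Rightarrow> 'f::real_normed_vector) \<Rightarrow> bool"
  where
    "Ck_on 0 S f \<longleftrightarrow> continuous_on S f"
  | "Ck_on (Suc k) S f \<longleftrightarrow>
       (\<forall>x\<in>S. f differentiable (at x)) \<and> (\<forall>h. Ck_on k S (\<lambda>x. frechet_derivative f (at x) h))"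

definition smooth_on :: "'e::real_normed_vector set \<Rightarrow> ('e \<Rightarrow> 'f::real_normed_vector) \<Rightarrow> bool"
  where "smooth_on S f \<longleftrightarrow> (\<forall>k. Ck_on k S f)"

text \<open>A chart is a coordinate domain together with its coordinate map, whose values off the
  domain are irrelevant.\<close>

type_synonym ('m, 'e) chart = "'m set \<times> ('m \<Rightarrow> 'e)"

text \<open>
  The model space is an arbitrary finite-dimensional \<^class>\<open>real_inner\<close> type, i.e. a Euclidean
  space; the class \<^class>\<open>euclidean_space\<close> would exclude dimension 0. The atlas need not be
  maximal, since it determines the smooth structure.
\<close>

definition smooth_manifold :: "'m topology \<Rightarrow> ('m, 'e::real_inner) chart set \<Rightarrow> bool"
  where "smooth_manifold X A \<longleftrightarrow>
    (\<exists>B :: 'e set. finite B \<and> span B = UNIV) \<and>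
    Hausdorff_space X \<and> second_countable X \<and>
    (\<forall>(U, \<phi>)\<in>A. openin X U \<and> open (\<phi> ` U) \<and>
       homeomorphic_map (subtopology X U) (top_of_set (\<phi> ` U)) \<phi>) \<and>
    (\<Union>(U, \<phi>)\<in>A. U) = topspace X \<and>
    (\<forall>(U, \<phi>)\<in>A. \<forall>(V, \<psi>)\<in>A. smooth_on (\<phi> ` (U \<inter> V)) (\<psi> \<circ> inv_into U \<phi>))"

definition smooth_fun :: "('m, 'e::real_inner) chart set \<Rightarrow> ('m \<Rightarrow> real) \<Rightarrow> bool"
  where "smooth_fun A f \<longleftrightarrow> (\<forall>(U, \<phi>)\<in>A. smooth_on (\<phi> ` U) (f \<circ> inv_into U \<phi>))"


section \<open>Tangent spaces, differentials and 3-vector fields\<close>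

text \<open>
  A tangent vector at \<open>p\<close> is a family of coordinate vectors, one for each chart around \<open>p\<close>, related
  by the derivatives of the transition maps; it is set to 0 on all other index values.
\<close>

definition tangent_space ::
  "('m, 'e::real_inner) chart set \<Rightarrow> 'm \<Rightarrow> (('m, 'e) chart \<Rightarrow> 'e) set"
  where "tangent_space A p = {v.
    (\<forall>c. \<not> (c \<in> A \<and> p \<in> fst c) \<longrightarrow> v c = 0) \<and>
    (\<forall>(U, \<phi>)\<in>A. \<forall>(V, \<psi>)\<in>A. p \<in> U \<inter> V \<longrightarrow>
       v (V, \<psi>) = frechet_derivative (\<psi> \<circ> inv_into U \<phi>) (at (\<phi> p)) (v (U, \<phi>)))}"

lemma subspace_tangent_space:
  assumes "smooth_manifold X A"
  shows "subspace (tangent_space A p)"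
proof -
  have lin: "linear (frechet_derivative (\<psi> \<circ> inv_into U \<phi>) (at (\<phi> p)))"
    if "(U, \<phi>) \<in> A" "(V, \<psi>) \<in> A" "p \<in> U \<inter> V" for U \<phi> V \<psi>
  proof -
    have "smooth_on (\<phi> ` (U \<inter> V)) (\<psi> \<circ> inv_into U \<phi>)"
      using assms that unfolding smooth_manifold_def by fastforce
    then have "Ck_on (Suc 0) (\<phi> ` (U \<inter> V)) (\<psi> \<circ> inv_into U \<phi>)"
      unfolding smooth_on_def by blast
    then have "(\<psi> \<circ> inv_into U \<phi>) differentiable (at (\<phi> p))"
      using that by auto
    then show ?thesis
      by (rule linear_frechet_derivative)
  qed
  have mem: "v \<in> tangent_space A p \<longleftrightarrow>
    (\<forall>c. \<not> (c \<in> A \<and> p \<in> fst c) \<longrightarrow> v c = 0) \<and>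
    (\<forall>U \<phi> V \<psi>. (U, \<phi>) \<in> A \<and> (V, \<psi>) \<in> A \<and> p \<in> U \<inter> V \<longrightarrow>
       v (V, \<psi>) = frechet_derivative (\<psi> \<circ> inv_into U \<phi>) (at (\<phi> p)) (v (U, \<phi>)))" for v
    unfolding tangent_space_def by fast
  have zero: "v c = 0" if "v \<in> tangent_space A p" "\<not> (c \<in> A \<and> p \<in> fst c)" for v c
    using that(1)[unfolded mem, THEN conjunct1, rule_format, OF that(2)] .
  have trans: "v (V, \<psi>) = frechet_derivative (\<psi> \<circ> inv_into U \<phi>) (at (\<phi> p)) (v (U, \<phi>))"
    if "v \<in> tangent_space A p" "(U, \<phi>) \<in> A \<and> (V, \<psi>) \<in> A \<and> p \<in> U \<inter> V" for v U \<phi> V \<psi>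
    by (rule that(1)[unfolded mem, THEN conjunct2, THEN spec, THEN spec, THEN spec, THEN spec,
          THEN mp, OF that(2)])
  show ?thesis
  proof (rule subspaceI)
    show "0 \<in> tangent_space A p"
      unfolding mem
    proof (intro conjI allI impI)
      fix U \<phi> V \<psi> assume "(U, \<phi>) \<in> A \<and> (V, \<psi>) \<in> A \<and> p \<in> U \<inter> V"
      then have "linear (frechet_derivative (\<psi> \<circ> inv_into U \<phi>) (at (\<phi> p)))"
        using lin by blast
      then show "0 (V, \<psi>) =
          frechet_derivative (\<psi> \<circ> inv_into U \<phi>) (at (\<phi> p)) (0 (U, \<phi>))"
        by (metis linear_0 zero_fun_apply)
    qed simp
  next
    fix v w assume vw: "v \<in> tangent_space A p" "w \<in> tangent_space A p"
    show "v + w \<in> tangent_space A p"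
      unfolding mem
    proof (intro conjI allI impI)
      fix c assume "\<not> (c \<in> A \<and> p \<in> fst c)"
      then have "v c = 0" "w c = 0"
        using zero vw by blast+
      then show "(v + w) c = 0" by simp
    next
      fix U \<phi> V \<psi> assume *: "(U, \<phi>) \<in> A \<and> (V, \<psi>) \<in> A \<and> p \<in> U \<inter> V"
      let ?D = "frechet_derivative (\<psi> \<circ> inv_into U \<phi>) (at (\<phi> p))"
      have "v (V, \<psi>) = ?D (v (U, \<phi>))" "w (V, \<psi>) = ?D (w (U, \<phi>))"
        by (rule trans[OF vw(1) *], rule trans[OF vw(2) *])
      moreover have "linear ?D" using * lin by blast
      ultimately show "(v + w) (V, \<psi>) = ?D ((v + w) (U, \<phi>))"
        by (simp add: linear_add)
    qed
  next
    fix r v assume v: "v \<in> tangent_space A p"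
    show "r *\<^sub>R v \<in> tangent_space A p"
      unfolding mem
    proof (intro conjI allI impI)
      fix c assume "\<not> (c \<in> A \<and> p \<in> fst c)"
      then have "v c = 0"
        using zero v by blast
      then show "(r *\<^sub>R v) c = 0" by simp
    next
      fix U \<phi> V \<psi> assume *: "(U, \<phi>) \<in> A \<and> (V, \<psi>) \<in> A \<and> p \<in> U \<inter> V"
      let ?D = "frechet_derivative (\<psi> \<circ> inv_into U \<phi>) (at (\<phi> p))"
      have "v (V, \<psi>) = ?D (v (U, \<phi>))"
        by (rule trans[OF v *])
      moreover have "linear ?D" using * lin by blast
      ultimately show "(r *\<^sub>R v) (V, \<psi>) = ?D ((r *\<^sub>R v) (U, \<phi>))"
        by (simp add: linear_scale)
    qed
  qed
qed

text \<open>
  The differential at \<open>p\<close> of a real function that is smooth near \<open>p\<close>, as an element of the dual of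
  the tangent space. By the chain rule the choice of the chart does not matter.
\<close>

definition differential ::
  "('m, 'e::real_inner) chart set \<Rightarrow> ('m \<Rightarrow> real) \<Rightarrow> 'm \<Rightarrow> (('m, 'e) chart \<Rightarrow> 'e) \<Rightarrow> real"
  where "differential A f p = (\<lambda>v.
    if v \<in> tangent_space A p
    then (let c = (SOME c. c \<in> A \<and> p \<in> fst c)
          in frechet_derivative (f \<circ> inv_into (fst c) (snd c)) (at (snd c p)) (v c))
    else 0)"

text \<open>
  In a chart \<open>(U, \<phi>)\<close>, the functions \<open>\<lambda>q. a \<bullet> \<phi> q\<close> are the linear coordinates, so smoothness of the
  section \<open>P\<close> says that its components in each chart of the atlas are smooth.
\<close>

definition trivector_field ::
  "'m topology \<Rightarrow> ('m, 'e::real_inner) chart set \<Rightarrow>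
    ('m \<Rightarrow> (('m, 'e) chart \<Rightarrow> 'e) trivector) \<Rightarrow> bool"
  where "trivector_field X A P \<longleftrightarrow>
    (\<forall>p\<in>topspace X. P p \<in> exterior_cube (tangent_space A p)) \<and>
    (\<forall>(U, \<phi>)\<in>A. \<forall>a b c. smooth_on (\<phi> ` U)
       ((\<lambda>p. P p (differential A (\<lambda>q. a \<bullet> \<phi> q) p)
                 (differential A (\<lambda>q. b \<bullet> \<phi> q) p)
                 (differential A (\<lambda>q. c \<bullet> \<phi> q) p)) \<circ> inv_into U \<phi>))"


section \<open>Ternary Poisson brackets\<close>

definition bracket3 ::
  "('m, 'e::real_inner) chart set \<Rightarrow> ('m \<Rightarrow> (('m, 'e) chart \<Rightarrow> 'e) trivector) \<Rightarrow>
    ('m \<Rightarrow> real) \<Rightarrow> ('m \<Rightarrow> real) \<Rightarrow> ('m \<Rightarrow> real) \<Rightarrow> 'm \<Rightarrow> real"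
  where "bracket3 A P f g h = (\<lambda>p. P p (differential A f p) (differential A g p) (differential A h p))"

definition ternary_Poisson ::
  "'m topology \<Rightarrow> ('m, 'e::real_inner) chart set \<Rightarrow>
    ('m \<Rightarrow> (('m, 'e) chart \<Rightarrow> 'e) trivector) \<Rightarrow> bool"
  where "ternary_Poisson X A P \<longleftrightarrow>
    (\<forall>f :: nat \<Rightarrow> 'm \<Rightarrow> real. (\<forall>i\<in>{1..5}. smooth_fun A (f i)) \<longrightarrow>
      (\<forall>p\<in>topspace X.
        (\<Sum>\<sigma> | \<sigma> permutes {1..5}. of_int (sign \<sigma>) *
           bracket3 A P (bracket3 A P (f (\<sigma> 1)) (f (\<sigma> 2)) (f (\<sigma> 3))) (f (\<sigma> 4)) (f (\<sigma> 5)) p) = 0))"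

end

theory Submission
  imports Defs
begin

text \<open>
  In a chart, a 3-vector field is a smoothly varying alternating trilinear form \<open>T\<close> on the model
  space, and \<open>{f, g, h} = T (grad f) (grad g) (grad h)\<close> (\<open>bracket3_eq_components\<close>). The bridge between
  the two sides is a quadratic condition at each point, \<open>contractions_decomposable\<close>: for every
  \<open>\<xi>\<close>, the 2-form \<open>T \<xi>\<close> satisfies \<open>T \<xi> \<and> T \<xi> = 0\<close>. It is equivalent to decomposability of \<open>T\<close>. One
  direction is a polynomial identity. For the other one, if \<open>T a b c \<noteq> 0\<close>, the condition and its
  polarization force \<open>T\<close> to vanish as soon as one argument is annihilated by the three linear
  forms \<open>T _ b c\<close>, \<open>T a _ c\<close> and \<open>T a b _\<close>; so \<open>T\<close> is a multiple of their wedge product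
  (\<open>eq_wedge_forms_of_contractions_decomposable\<close>).

  If the generalized Jacobi identity holds, test it at a point with coordinate \<open>y0\<close> on
  \<open>f\<^sub>1 = (\<xi> \<bullet> (y - y0))\<^sup>2 / 2\<close> and linear functions \<open>f\<^sub>2, \<dots>, f\<^sub>5\<close>, all cut off by a bump function. The
  differential of \<open>f\<^sub>1\<close> vanishes at \<open>y0\<close>, so only terms with the second derivative of \<open>f\<^sub>1\<close> survive,
  and they add up to a multiple of \<open>T \<xi> \<and> T \<xi>\<close> evaluated on the other four differentials
  (\<open>contractions_decomposable_of_ternary_Poisson\<close>).

  Conversely, let \<open>P\<close> be decomposable near a point. Where \<open>P\<close> vanishes, so does every double bracket.
  Elsewhere \<open>T a b c \<noteq> 0\<close> for suitable fixed vectors, and nearby \<open>T = \<kappa> (u \<and> v \<and> w)\<close>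
  where \<open>u\<close>, \<open>v\<close>, \<open>w\<close> are the three forms above and \<open>\<kappa> = 1 / (T a b c)\<^sup>2\<close>; this makes
  the factors differentiable although decomposability is only given pointwise. By the product rule,
  each term of \<open>{{f\<^sub>1, f\<^sub>2, f\<^sub>3}, f\<^sub>4, f\<^sub>5}\<close> is a product in which the inner bracket contributes at least
  two of \<open>u\<close>, \<open>v\<close>, \<open>w\<close> undifferentiated and the outer one contributes two of them as well. Hence one
  of the forms occurs twice, and the term is killed by antisymmetrization
  (\<open>alternation_vanishes_of_decomposable\<close>).
\<close>

section \<open>Finite-dimensional inner product spaces\<close>

text \<open>
  The model space is a finite-dimensional inner product space without a distinguished basis. Every
  use of an orthonormal basis below goes through the expansion of a vector in it, so this expansion
  is taken as the definition.
\<close>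

definition Parseval_frame :: "'a::real_inner set \<Rightarrow> bool"
  where "Parseval_frame E \<longleftrightarrow> finite E \<and> (\<forall>x. (\<Sum>e\<in>E. (x \<bullet> e) *\<^sub>R e) = x)"

lemma Parseval_frame_exists:
  fixes B :: "'a::real_inner set"
  assumes "finite B" "span B = UNIV"
  obtains E :: "'a set" where "Parseval_frame E"
proof -
  obtain C :: "'a set" where C: "finite C" "span C = UNIV" "pairwise orthogonal C"
    using basis_orthogonal[OF assms(1)] assms(2) by auto
  define E where "E = (\<lambda>c. c /\<^sub>R norm c) ` (C - {0})"
  have fin: "finite E" using C by (simp add: E_def)
  have inner_E: "d \<bullet> e = (if d = e then 1 else 0)" if "d \<in> E" "e \<in> E" for d e
  proof -
    obtain c c' where c: "c \<in> C" "c \<noteq> 0" "d = c /\<^sub>R norm c"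
      "c' \<in> C" "c' \<noteq> 0" "e = c' /\<^sub>R norm c'"
      using \<open>d \<in> E\<close> \<open>e \<in> E\<close> unfolding E_def by auto
    show ?thesis
    proof (cases "c = c'")
      case True
      then show ?thesis using c by (simp add: dot_square_norm power2_eq_square)
    next
      case False
      then have "c \<bullet> c' = 0" using C(3) c unfolding pairwise_def orthogonal_def by blast
      then have "d \<bullet> e = 0" using c by simp
      moreover have "d \<bullet> d = 1" using c by (simp add: dot_square_norm power2_eq_square)
      ultimately show ?thesis by auto
    qed
  qed
  have "span C \<subseteq> span E"
  proof (rule span_minimal)
    show "C \<subseteq> span E"
    proof
      fix c assume "c \<in> C"
      show "c \<in> span E"
      proof (cases "c = 0")
        case False
        then have "c /\<^sub>R norm c \<in> E" using \<open>c \<in> C\<close> by (auto simp: E_def)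
        then have "norm c *\<^sub>R (c /\<^sub>R norm c) \<in> span E"
          by (intro span_scale span_base)
        then show ?thesis using False by simp
      qed (simp add: span_zero)
    qed
  qed simp
  then have spanE: "x \<in> span E" for x using C(2) by auto
  have "(\<Sum>e\<in>E. (x \<bullet> e) *\<^sub>R e) = x" for x
    using spanE[of x]
  proof (induction rule: span_induct_alt)
    case base
    then show ?case by simp
  next
    case (step c d y)
    have "(\<Sum>e\<in>E. (d \<bullet> e) *\<^sub>R e) = (\<Sum>e\<in>E. if d = e then e else 0)"
      using step inner_E by (intro sum.cong) auto
    also have "\<dots> = d" using step fin by simp
    finally show ?case using step
      by (simp add: inner_add_left scaleR_add_left sum.distrib flip: scaleR_scaleR scaleR_sum_right)
  qed
  then show ?thesis using fin that unfolding Parseval_frame_def by blast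
qed

lemma Parseval_frame_finite: "Parseval_frame E \<Longrightarrow> finite E"
  by (simp add: Parseval_frame_def)

lemma linear_frame_expansion:
  assumes "Parseval_frame E" "linear f"
  shows "f x = (\<Sum>e\<in>E. (x \<bullet> e) *\<^sub>R f e)"
proof -
  have "f x = f (\<Sum>e\<in>E. (x \<bullet> e) *\<^sub>R e)" using assms(1) by (simp add: Parseval_frame_def)
  then show ?thesis using assms(2) by (simp add: linear_sum linear_scale)
qed

lemma linear_functional_eq_inner:
  fixes f :: "'a::real_inner \<Rightarrow> real"
  assumes "Parseval_frame E" "linear f"
  shows "f x = (\<Sum>e\<in>E. f e *\<^sub>R e) \<bullet> x"
  using linear_frame_expansion[OF assms, of x]
  by (simp add: inner_sum_left inner_commute[of x] mult.commute)

text \<open>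
  A closed ball is a closed subset of the cube of all \<open>\<Sum>e. t e *\<^sub>R e\<close> with bounded coefficients. The
  cube is compact, because adding one more vector replaces it by the continuous image of its product
  with an interval.
\<close>

lemma compact_cball_frame:
  fixes x0 :: "'a::real_inner" and E :: "'a set"
  assumes "Parseval_frame E"
  shows "compact (cball x0 r)"
proof -
  define M where "M = (\<Sum>e\<in>E. norm e)"
  define cube where "cube D = {x. \<exists>t. (\<forall>e\<in>D. \<bar>t e\<bar> \<le> \<bar>r\<bar> * M) \<and> x = (\<Sum>e\<in>D. t e *\<^sub>R e)}"
    for D :: "'a set"
  have fin: "finite E" using assms by (rule Parseval_frame_finite)
  have "compact (cube D)" if "finite D" for D
    using that
  proof (induction D)
    case empty
    have "cube {} = {0}" by (auto simp: cube_def)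
    then show ?case by simp
  next
    case (insert d D)
    let ?I = "{- (\<bar>r\<bar> * M)..\<bar>r\<bar> * M}"
    have "cube (insert d D) = (\<lambda>(s, x). s *\<^sub>R d + x) ` (?I \<times> cube D)" (is "_ = ?R")
    proof
      show "cube (insert d D) \<subseteq> ?R"
      proof
        fix x assume "x \<in> cube (insert d D)"
        then obtain t where t: "\<forall>e\<in>insert d D. \<bar>t e\<bar> \<le> \<bar>r\<bar> * M"
          "x = (\<Sum>e\<in>insert d D. t e *\<^sub>R e)" unfolding cube_def by blast
        then have "(t d, \<Sum>e\<in>D. t e *\<^sub>R e) \<in> ?I \<times> cube D"
          unfolding cube_def by (auto simp: abs_le_iff)
        moreover have "x = t d *\<^sub>R d + (\<Sum>e\<in>D. t e *\<^sub>R e)" using t insert by simp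
        ultimately show "x \<in> ?R" by (metis (no_types, lifting) case_prod_conv image_eqI)
      qed
      show "?R \<subseteq> cube (insert d D)"
      proof clarify
        fix s x assume s: "s \<in> ?I" and "x \<in> cube D"
        then obtain t where t: "\<forall>e\<in>D. \<bar>t e\<bar> \<le> \<bar>r\<bar> * M" "x = (\<Sum>e\<in>D. t e *\<^sub>R e)"
          unfolding cube_def by blast
        have "(\<Sum>e\<in>D. (t(d := s)) e *\<^sub>R e) = (\<Sum>e\<in>D. t e *\<^sub>R e)"
          using insert by (intro sum.cong) auto
        then have "s *\<^sub>R d + x = (\<Sum>e\<in>insert d D. (t(d := s)) e *\<^sub>R e)"
          using insert t by simp
        moreover have "\<forall>e\<in>insert d D. \<bar>(t(d := s)) e\<bar> \<le> \<bar>r\<bar> * M"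
          using t s by auto
        ultimately show "s *\<^sub>R d + x \<in> cube (insert d D)" unfolding cube_def by blast
      qed
    qed
    moreover have "compact ?R"
      by (intro compact_continuous_image compact_Times insert.IH compact_Icc)
        (auto intro!: continuous_intros simp: case_prod_unfold)
    ultimately show ?case by simp
  qed
  then have cpt: "compact (cube E)" using fin by blast
  have "cball 0 r \<subseteq> cube E"
  proof
    fix x :: 'a assume "x \<in> cball 0 r"
    then have x: "norm x \<le> \<bar>r\<bar>" by simp
    have "\<bar>x \<bullet> e\<bar> \<le> \<bar>r\<bar> * M" if "e \<in> E" for e
    proof -
      have "norm e \<le> M" unfolding M_def using that fin by (intro member_le_sum) auto
      then have "norm x * norm e \<le> \<bar>r\<bar> * M" using x by (intro mult_mono) auto
      then show ?thesis using Cauchy_Schwarz_ineq2[of x e] by linarith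
    qed
    moreover have "x = (\<Sum>e\<in>E. (x \<bullet> e) *\<^sub>R e)" using assms by (simp add: Parseval_frame_def)
    ultimately show "x \<in> cube E" unfolding cube_def by blast
  qed
  then have "compact (cball (0::'a) r)"
    using compact_Int_closed[OF cpt closed_cball] by (metis inf.absorb2)
  then have "compact ((+) x0 ` cball 0 r)" by (rule compact_translation)
  then show ?thesis by simp
qed

section \<open>Closure properties of smooth maps\<close>

lemma Ck_on_cong:
  assumes "open S" "\<And>x. x \<in> S \<Longrightarrow> f x = g x" "Ck_on k S f"
  shows "Ck_on k S g"
  using assms(2,3)
proof (induction k arbitrary: f g)
  case 0
  then show ?case by (metis Ck_on.simps(1) continuous_on_cong)
next
  case (Suc k)
  have diff: "f differentiable (at x)" if "x \<in> S" for x using Suc.prems that by simp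
  have "g differentiable (at x)" if "x \<in> S" for x
    using diff[OF that] that assms(1) Suc.prems(1)
    unfolding differentiable_def by (meson has_derivative_transform_within_open)
  moreover have "frechet_derivative f (at x) = frechet_derivative g (at x)" if "x \<in> S" for x
    using frechet_derivative_transform_within_open[OF diff assms(1)] that Suc.prems(1) by blast
  ultimately show ?case
    using Suc.IH[OF _ Suc.prems(2)[unfolded Ck_on.simps, THEN conjunct2, THEN spec]] by simp
qed

lemma Ck_on_Suc_imp: "Ck_on (Suc k) S f \<Longrightarrow> Ck_on k S f"
proof (induction k arbitrary: f)
  case 0
  then show ?case
    by (simp add: differentiable_imp_continuous_on differentiable_at_imp_differentiable_on)
next
  case (Suc k)
  then show ?case by (metis Ck_on.simps(2))
qed

lemma Ck_on_Un:
  "open S \<Longrightarrow> open T \<Longrightarrow> Ck_on k S f \<Longrightarrow> Ck_on k T f \<Longrightarrow> Ck_on k (S \<union> T) f"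
  by (induction k arbitrary: f) (auto intro: continuous_on_open_Un)

lemma Ck_on_const: "Ck_on k S (\<lambda>x. c)"
  by (induction k arbitrary: c) auto

lemma bounded_linear_imp_Ck_on:
  assumes "bounded_linear f"
  shows "Ck_on k S f"
proof (cases k)
  case 0
  then show ?thesis using assms linear_continuous_on by auto
next
  case (Suc k')
  have "(f has_derivative f) (at x)" for x
    using assms by (simp add: bounded_linear_imp_has_derivative)
  moreover from this have "frechet_derivative f (at x) = f" for x
    by (metis frechet_derivative_at)
  ultimately show ?thesis using Suc by (auto simp: Ck_on_const differentiable_def)
qed

lemma Ck_on_add:
  assumes "open S" "Ck_on k S f" "Ck_on k S g"
  shows "Ck_on k S (\<lambda>x. f x + g x)"
  using assms(2,3)
proof (induction k arbitrary: f g)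
  case 0
  then show ?case by (simp add: continuous_on_add)
next
  case (Suc k)
  have D: "((\<lambda>x. f x + g x) has_derivative
      (\<lambda>h. frechet_derivative f (at x) h + frechet_derivative g (at x) h)) (at x)"
    if "x \<in> S" for x
    using Suc.prems that by (auto intro!: has_derivative_add simp: frechet_derivative_works)
  have "Ck_on k S (\<lambda>x. frechet_derivative (\<lambda>x. f x + g x) (at x) h)" for h
  proof (rule Ck_on_cong[OF assms(1)])
    show "Ck_on k S (\<lambda>x. frechet_derivative f (at x) h + frechet_derivative g (at x) h)"
      using Suc by simp
    show "frechet_derivative f (at x) h + frechet_derivative g (at x) h =
        frechet_derivative (\<lambda>x. f x + g x) (at x) h" if "x \<in> S" for x
      using frechet_derivative_at[OF D[OF that]] by metis
  qed
  then show ?case using D by (auto simp: differentiable_def)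
qed

lemma Ck_on_sum:
  assumes "open S" "\<And>i. i \<in> I \<Longrightarrow> Ck_on k S (f i)"
  shows "Ck_on k S (\<lambda>x. \<Sum>i\<in>I. f i x)"
  using assms(2)
  by (induction I rule: infinite_finite_induct) (auto intro: Ck_on_const Ck_on_add[OF assms(1)])

lemma Ck_on_scaleR:
  assumes "open S" "Ck_on k S f" "Ck_on k S g"
  shows "Ck_on k S (\<lambda>x. f x *\<^sub>R g x)"
  using assms(2,3)
proof (induction k arbitrary: f g)
  case 0
  then show ?case by (simp add: continuous_on_scaleR)
next
  case (Suc k)
  have D: "((\<lambda>x. f x *\<^sub>R g x) has_derivative
      (\<lambda>h. f x *\<^sub>R frechet_derivative g (at x) h + frechet_derivative f (at x) h *\<^sub>R g x)) (at x)"
    if "x \<in> S" for x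
    using Suc.prems that by (auto intro!: has_derivative_scaleR simp: frechet_derivative_works)
  have "Ck_on k S (\<lambda>x. frechet_derivative (\<lambda>x. f x *\<^sub>R g x) (at x) h)" for h
  proof (rule Ck_on_cong[OF assms(1)])
    show "Ck_on k S (\<lambda>x. f x *\<^sub>R frechet_derivative g (at x) h +
        frechet_derivative f (at x) h *\<^sub>R g x)"
      using Suc Ck_on_Suc_imp[OF Suc.prems(1)] Ck_on_Suc_imp[OF Suc.prems(2)]
      by (intro Ck_on_add[OF assms(1)] Suc.IH) auto
    show "f x *\<^sub>R frechet_derivative g (at x) h + frechet_derivative f (at x) h *\<^sub>R g x =
        frechet_derivative (\<lambda>x. f x *\<^sub>R g x) (at x) h" if "x \<in> S" for x
      using frechet_derivative_at[OF D[OF that]] by metis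
  qed
  then show ?case using D by (auto simp: differentiable_def)
qed

lemmas Ck_on_mult = Ck_on_scaleR[where 'b = real, unfolded real_scaleR_def]

lemma Ck_on_bounded_linear_compose:
  assumes "open S" "bounded_linear l" "Ck_on k S f"
  shows "Ck_on k S (\<lambda>x. l (f x))"
  using assms(3)
proof (induction k arbitrary: f)
  case 0
  then show ?case using bounded_linear.continuous_on[OF assms(2)] by simp
next
  case (Suc k)
  have D: "((\<lambda>x. l (f x)) has_derivative (\<lambda>h. l (frechet_derivative f (at x) h))) (at x)"
    if "x \<in> S" for x
  proof (rule bounded_linear.has_derivative[OF assms(2)])
    show "(f has_derivative frechet_derivative f (at x)) (at x)"
      using Suc.prems that by (simp flip: frechet_derivative_works)
  qed
  have "Ck_on k S (\<lambda>x. frechet_derivative (\<lambda>x. l (f x)) (at x) h)" for h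
  proof (rule Ck_on_cong[OF assms(1)])
    show "Ck_on k S (\<lambda>x. l (frechet_derivative f (at x) h))" using Suc by simp
    show "l (frechet_derivative f (at x) h) = frechet_derivative (\<lambda>x. l (f x)) (at x) h"
      if "x \<in> S" for x
      using frechet_derivative_at[OF D[OF that]] by metis
  qed
  then show ?case using D by (auto simp: differentiable_def)
qed

text \<open>
  Expanding the chain rule in a frame turns the directional derivative of \<open>f \<circ> g\<close> into a finite sum
  of products of components of the derivative of \<open>g\<close> with functions of the form \<open>h \<circ> g\<close>, where \<open>h\<close>
  is a directional derivative of \<open>f\<close>; this is what the induction on the order needs.
\<close>

lemma Ck_on_compose:
  fixes f :: "'a::real_inner \<Rightarrow> 'b::real_normed_vector" and g :: "'c::real_normed_vector \<Rightarrow> 'a"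
  assumes "Parseval_frame (E :: 'a set)" "open S" "g ` S \<subseteq> R"
    and "Ck_on k S g" "Ck_on k R f"
  shows "Ck_on k S (f \<circ> g)"
  using assms(4,5)
proof (induction k arbitrary: f)
  case 0
  then show ?case using assms(3) by (metis Ck_on.simps(1) continuous_on_compose continuous_on_subset)
next
  case (Suc k)
  have diff: "g differentiable (at x)" "f differentiable (at (g x))" if "x \<in> S" for x
    using Suc.prems that assms(3) by auto
  have "Ck_on k S (\<lambda>x. frechet_derivative (f \<circ> g) (at x) h)" for h
  proof (rule Ck_on_cong[OF assms(2)])
    show "Ck_on k S (\<lambda>x. \<Sum>e\<in>E. (frechet_derivative g (at x) h \<bullet> e) *\<^sub>R
        ((\<lambda>y. frechet_derivative f (at y) e) \<circ> g) x)"
    proof (intro Ck_on_sum Ck_on_scaleR assms(2))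
      show "Ck_on k S (\<lambda>x. frechet_derivative g (at x) h \<bullet> e)" for e
        using Suc.prems
        by (intro Ck_on_bounded_linear_compose[OF assms(2) bounded_linear_inner_left]) auto
      show "Ck_on k S ((\<lambda>y. frechet_derivative f (at y) e) \<circ> g)" for e
        using Suc.prems Ck_on_Suc_imp[OF Suc.prems(1)] by (intro Suc.IH) auto
    qed
    show "(\<Sum>e\<in>E. (frechet_derivative g (at x) h \<bullet> e) *\<^sub>R
        ((\<lambda>y. frechet_derivative f (at y) e) \<circ> g) x) = frechet_derivative (f \<circ> g) (at x) h"
      if "x \<in> S" for x
      by (simp only: frechet_derivative_compose[OF diff[OF that]] comp_apply
          linear_frame_expansion[OF assms(1) linear_frechet_derivative[OF diff(2)[OF that]],
            of "frechet_derivative g (at x) h"])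
  qed
  moreover have "f \<circ> g differentiable (at x)" if "x \<in> S" for x
    by (rule differentiable_chain_at[OF diff[OF that]])
  ultimately show ?case unfolding Ck_on.simps by blast
qed

section \<open>Bump functions\<close>

text \<open>
  The functions \<open>p (1 / t) exp (- 1 / t)\<close>, extended by 0 to the left half-line. Allowing an arbitrary
  polynomial \<open>p\<close> makes the family closed under differentiation, so smoothness follows by induction.
\<close>

definition flat_exp :: "real poly \<Rightarrow> real \<Rightarrow> real"
  where "flat_exp p t = (if t > 0 then poly p (1 / t) * exp (- 1 / t) else 0)"

lemma poly_over_exp_tendsto_0: "((\<lambda>x. poly p x / exp x) \<longlongrightarrow> (0::real)) at_top"
proof -
  have "((\<lambda>x. \<Sum>i\<le>degree p. coeff p i * (x ^ i / exp x)) \<longlongrightarrow> (\<Sum>i\<le>degree p. coeff p i * 0)) at_top"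
    by (intro tendsto_intros tendsto_power_div_exp_0)
  then show ?thesis by (simp add: poly_altdef sum_divide_distrib)
qed

lemma flat_exp_tendsto_0: "(flat_exp p \<longlongrightarrow> 0) (at 0)"
proof -
  have "((\<lambda>t. poly p (inverse t) / exp (inverse t)) \<longlongrightarrow> 0) (at_right (0::real))"
    using filterlim_compose[OF poly_over_exp_tendsto_0 filterlim_inverse_at_top_right] .
  moreover have "\<forall>\<^sub>F t in at_right 0. poly p (inverse t) / exp (inverse t) = flat_exp p t"
    unfolding eventually_at_right_field flat_exp_def
    by (intro exI[of _ 1]) (auto simp: exp_minus field_simps)
  ultimately have "(flat_exp p \<longlongrightarrow> 0) (at_right 0)"
    by (rule Lim_transform_eventually)
  moreover have "(flat_exp p \<longlongrightarrow> 0) (at_left 0)"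
    by (rule Lim_transform_eventually[of "\<lambda>_. 0"])
      (auto simp: flat_exp_def eventually_at_left_field intro!: exI[of _ "-1"])
  ultimately show ?thesis by (simp add: filterlim_split_at)
qed

lemma has_real_derivative_flat_exp:
  "(flat_exp p has_real_derivative flat_exp ([:0, 0, 1:] * (p - pderiv p)) t) (at t)"
proof -
  consider "t < 0" | "t = 0" | "t > 0" by linarith
  then show ?thesis
  proof cases
    case 1
    have "((\<lambda>_. 0) has_real_derivative 0) (at t)" by simp
    then have "(flat_exp p has_real_derivative 0) (at t)"
      by (rule has_field_derivative_transform_within_open[of _ _ _ "{..<0}"])
        (use 1 in \<open>auto simp: flat_exp_def\<close>)
    then show ?thesis using 1 by (simp add: flat_exp_def)
  next
    case 2
    \<comment> \<open>the difference quotient at 0 stays in the family, and all its members tend to 0 there\<close>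
    have "flat_exp p h / h = flat_exp ([:0, 1:] * p) h" for h
      by (simp add: flat_exp_def field_simps)
    then have "((\<lambda>h. (flat_exp p (0 + h) - flat_exp p 0) / h) \<longlongrightarrow> 0) (at 0)"
      using flat_exp_tendsto_0[of "[:0, 1:] * p"] by (simp add: flat_exp_def[of _ 0])
    then show ?thesis using 2 by (simp add: DERIV_def flat_exp_def)
  next
    case 3
    have "((\<lambda>t. poly p (1 / t) * exp (- 1 / t)) has_real_derivative
        flat_exp ([:0, 0, 1:] * (p - pderiv p)) t) (at t)"
      using 3 by (auto intro!: derivative_eq_intros DERIV_chain2[OF poly_DERIV]
          simp: flat_exp_def field_simps power2_eq_square)
    then show ?thesis
      by (rule has_field_derivative_transform_within_open[of _ _ _ "{0<..}"])
        (use 3 in \<open>auto simp: flat_exp_def\<close>)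
  qed
qed

lemma Ck_on_flat_exp: "Ck_on k UNIV (flat_exp p)"
proof (induction k arbitrary: p)
  case 0
  then show ?case
    using has_real_derivative_flat_exp by (auto intro!: continuous_at_imp_continuous_on DERIV_isCont)
next
  case (Suc k)
  define q where "q = [:0, 0, 1:] * (p - pderiv p)"
  have D: "(flat_exp p has_derivative (\<lambda>h. h * flat_exp q t)) (at t)" for t
    using has_real_derivative_flat_exp[of p t] unfolding q_def has_field_derivative_def
    by (simp add: mult.commute[of _ "flat_exp _ t"])
  have "Ck_on k UNIV (\<lambda>t. h * flat_exp q t)" for h
    by (intro Ck_on_mult Ck_on_const Suc.IH) simp
  then have "Ck_on k UNIV (\<lambda>t. frechet_derivative (flat_exp p) (at t) h)" for h
    by (simp flip: frechet_derivative_at[OF D])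
  moreover have "flat_exp p differentiable (at t)" for t
    using D by (auto simp: differentiable_def)
  ultimately show ?case by simp
qed

lemma Parseval_frame_real: "Parseval_frame {1::real}"
  by (simp add: Parseval_frame_def)

text \<open>
  Two applications of \<open>s t = exp (- 1 / t)\<close> produce a plateau: \<open>s\<close> vanishes exactly on the
  nonpositive numbers, so \<open>1 - s (\<kappa> - s t) / s \<kappa>\<close> is 0 for \<open>t \<le> 0\<close> and 1 as soon as
  \<open>s t \<ge> \<kappa>\<close>. It is evaluated at \<open>r\<^sup>2 - \<bar>x - x0\<bar>\<^sup>2\<close>.
\<close>

lemma smooth_bump:
  fixes x0 :: "'a::real_inner"
  assumes "r > 0"
  obtains \<rho> :: "'a \<Rightarrow> real" and \<delta> where "\<And>k. Ck_on k UNIV \<rho>" "\<delta> > 0"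
    "\<And>x. x \<in> ball x0 \<delta> \<Longrightarrow> \<rho> x = 1" "\<And>x. x \<notin> cball x0 r \<Longrightarrow> \<rho> x = 0"
proof -
  define s where "s = flat_exp 1"
  have s_0: "s t = 0" if "t \<le> 0" for t using that by (simp add: s_def flat_exp_def)
  have s_pos: "s t > 0" if "t > 0" for t using that by (simp add: s_def flat_exp_def)
  have s_mono: "s t \<le> s t'" if "0 < t" "t \<le> t'" for t t'
    using that by (simp add: s_def flat_exp_def frac_le)
  define g where "g x = r\<^sup>2 + (-1) * ((x - x0) \<bullet> (x - x0))" for x
  have Ck_g: "Ck_on k UNIV g" for k
  proof (cases k)
    case 0
    then show ?thesis by (simp add: g_def continuous_intros)
  next
    case (Suc k')
    have D: "(g has_derivative (\<lambda>h. (-2) * ((x - x0) \<bullet> h))) (at x)" for x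
      unfolding g_def by (auto intro!: derivative_eq_intros simp: inner_commute)
    have "(\<lambda>x. (-2) * ((x - x0) \<bullet> h)) = (\<lambda>x. (-2) * (x \<bullet> h) + 2 * (x0 \<bullet> h))" for h
      by (auto simp: algebra_simps)
    moreover have "Ck_on k' UNIV (\<lambda>x. (-2) * (x \<bullet> h) + 2 * (x0 \<bullet> h))" for h
      by (intro Ck_on_add Ck_on_mult Ck_on_const bounded_linear_imp_Ck_on
          bounded_linear_inner_left) auto
    ultimately have "Ck_on k' UNIV (\<lambda>x. frechet_derivative g (at x) h)" for h
      by (simp flip: frechet_derivative_at[OF D])
    then show ?thesis using D Suc by (auto simp: differentiable_def)
  qed
  define \<kappa> where "\<kappa> = s (r\<^sup>2 / 2)"
  have \<kappa>: "\<kappa> > 0" unfolding \<kappa>_def using assms by (intro s_pos) simp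
  define \<rho> where "\<rho> x = 1 + (- 1 / s \<kappa>) * s (\<kappa> + (-1) * s (g x))" for x
  have Ck_s: "Ck_on k UNIV (\<lambda>x. s (f x))" if "Ck_on k UNIV f" for k and f :: "'a \<Rightarrow> real"
    using Ck_on_compose[OF Parseval_frame_real open_UNIV subset_UNIV that, of s] Ck_on_flat_exp
    unfolding s_def comp_def by blast
  have "Ck_on k UNIV \<rho>" for k
    unfolding \<rho>_def by (intro Ck_on_add Ck_on_mult Ck_on_const Ck_s Ck_g) auto
  moreover have "\<rho> x = 1" if "x \<in> ball x0 (r / 2)" for x
  proof -
    have "norm (x - x0) \<le> r / 2" using that by (simp add: dist_norm norm_minus_commute)
    then have "(norm (x - x0))\<^sup>2 \<le> (r / 2)\<^sup>2" by (intro power_mono) auto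
    then have "(norm (x - x0))\<^sup>2 * 4 \<le> r\<^sup>2" by (simp add: power_divide)
    moreover have "g x = r\<^sup>2 - (norm (x - x0))\<^sup>2" by (simp add: g_def dot_square_norm)
    ultimately have "r\<^sup>2 / 2 \<le> g x"
      using zero_le_power2[of "norm (x - x0)"] zero_le_power2[of r] by linarith
    then have "\<kappa> \<le> s (g x)" unfolding \<kappa>_def using assms by (intro s_mono) auto
    then show ?thesis by (simp add: \<rho>_def s_0)
  qed
  moreover have "\<rho> x = 0" if "x \<notin> cball x0 r" for x
  proof -
    have "r \<le> norm (x - x0)" using that by (simp add: dist_norm norm_minus_commute)
    then have "r\<^sup>2 \<le> (norm (x - x0))\<^sup>2" using assms by (intro power_mono) auto
    then have "s (g x) = 0" by (intro s_0) (simp add: g_def dot_square_norm)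
    then show ?thesis using s_pos[OF \<kappa>] by (simp add: \<rho>_def)
  qed
  ultimately show ?thesis using that[of \<rho> "r / 2"] assms by simp
qed

section \<open>Decomposability of alternating trilinear forms\<close>

text \<open>
  The wedge product of three forms, evaluated on three arguments. The index type is arbitrary, since
  the same expression is used for linear forms on the model space and for the numbers that they
  assign to a numbered family of gradients.
\<close>

definition wedge_forms ::
  "('i \<Rightarrow> real) \<Rightarrow> ('i \<Rightarrow> real) \<Rightarrow> ('i \<Rightarrow> real) \<Rightarrow> 'i \<Rightarrow> 'i \<Rightarrow> 'i \<Rightarrow> real"
  where "wedge_forms u v w x y z =
    u x * (v y * w z - v z * w y) - v x * (u y * w z - u z * w y) + w x * (u y * v z - u z * v y)"

definition alternating_trilinear :: "('a::real_vector \<Rightarrow> 'a \<Rightarrow> 'a \<Rightarrow> real) \<Rightarrow> bool"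
  where "alternating_trilinear T \<longleftrightarrow>
    (\<forall>y z. linear (\<lambda>x. T x y z)) \<and>
    (\<forall>x y z. T y x z = - T x y z \<and> T x z y = - T x y z)"

lemma alternating_trilinear_swap:
  assumes "alternating_trilinear T"
  shows "T y x z = - T x y z" "T x z y = - T x y z"
  using assms unfolding alternating_trilinear_def by blast+

lemma alternating_trilinear_linear:
  assumes "alternating_trilinear T"
  shows "linear (\<lambda>x. T x y z)" "linear (\<lambda>x. T y x z)" "linear (\<lambda>x. T y z x)"
proof -
  have 1: "linear (\<lambda>x. T x y z)" for y z
    using assms unfolding alternating_trilinear_def by blast
  show "linear (\<lambda>x. T x y z)" by (rule 1)
  have 2: "linear (\<lambda>x. T y x z)" for y z
    using linear_compose_neg[OF 1[of y z]] unfolding alternating_trilinear_swap(1)[OF assms, of y] .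
  then show "linear (\<lambda>x. T y x z)" .
  show "linear (\<lambda>x. T y z x)"
    using linear_compose_neg[OF 2[of y z]] unfolding alternating_trilinear_swap(2)[OF assms, of y z] .
qed

lemma alternating_trilinear_repeated:
  assumes "alternating_trilinear T"
  shows "T x x z = 0" "T x z z = 0" "T x z x = 0"
  using alternating_trilinear_swap(1)[OF assms, of x x z] alternating_trilinear_swap(2)[OF assms, of x z z]
    alternating_trilinear_swap(1)[OF assms, of x z x] alternating_trilinear_swap(2)[OF assms, of x x z]
  by linarith+

text \<open>
  The contraction \<open>T \<xi>\<close> is a 2-form, and the displayed expression is half of \<open>T \<xi> \<and> T \<xi>\<close> evaluated
  on four vectors; so the condition says that every contraction has rank at most 2.
\<close>

definition contractions_decomposable :: "('a \<Rightarrow> 'a \<Rightarrow> 'a \<Rightarrow> real) \<Rightarrow> bool"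
  where "contractions_decomposable T \<longleftrightarrow>
    (\<forall>\<xi> x y z t. T \<xi> x y * T \<xi> z t - T \<xi> x z * T \<xi> y t + T \<xi> x t * T \<xi> y z = 0)"

lemma contractions_decomposable_wedge_forms: "contractions_decomposable (wedge_forms u v w)"
proof -
  have "(p1 * (b1 * c2 - b2 * c1) - q1 * (a1 * c2 - a2 * c1) + r1 * (a1 * b2 - a2 * b1)) *
      (p1 * (b3 * c4 - b4 * c3) - q1 * (a3 * c4 - a4 * c3) + r1 * (a3 * b4 - a4 * b3)) -
      (p1 * (b1 * c3 - b3 * c1) - q1 * (a1 * c3 - a3 * c1) + r1 * (a1 * b3 - a3 * b1)) *
      (p1 * (b2 * c4 - b4 * c2) - q1 * (a2 * c4 - a4 * c2) + r1 * (a2 * b4 - a4 * b2)) +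
      (p1 * (b1 * c4 - b4 * c1) - q1 * (a1 * c4 - a4 * c1) + r1 * (a1 * b4 - a4 * b1)) *
      (p1 * (b2 * c3 - b3 * c2) - q1 * (a2 * c3 - a3 * c2) + r1 * (a2 * b3 - a3 * b2)) = 0"
    for p1 q1 r1 a1 a2 a3 a4 b1 b2 b3 b4 c1 c2 c3 c4 :: real
    by algebra
  then show ?thesis unfolding contractions_decomposable_def wedge_forms_def by blast
qed

text \<open>
  A quadratic condition in \<open>\<xi>\<close> for all \<open>\<xi>\<close> implies the associated bilinear condition in \<open>\<xi>\<close> and \<open>\<eta>\<close>.
\<close>

lemma contractions_polarized:
  assumes T: "alternating_trilinear T" and "contractions_decomposable T"
  shows "T \<xi> x y * T \<eta> z t - T \<xi> x z * T \<eta> y t + T \<xi> x t * T \<eta> y z +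
    (T \<eta> x y * T \<xi> z t - T \<eta> x z * T \<xi> y t + T \<eta> x t * T \<xi> y z) = 0"
proof -
  have rel: "T \<zeta> x y * T \<zeta> z t - T \<zeta> x z * T \<zeta> y t + T \<zeta> x t * T \<zeta> y z = 0" for \<zeta>
    using assms(2) unfolding contractions_decomposable_def by blast
  have add: "T (\<xi> + \<eta>) p q = T \<xi> p q + T \<eta> p q" for p q
    by (rule linear_add[OF alternating_trilinear_linear(1)[OF T]])
  show ?thesis using rel[of \<xi>] rel[of \<eta>] rel[of "\<xi> + \<eta>"] unfolding add
    by algebra
qed

text \<open>
  Split each vector into a combination of \<open>a\<close>, \<open>b\<close>, \<open>c\<close> and a remainder annihilated by the three linear
  forms on the right. The quadratic relation shows that \<open>T\<close> vanishes on a remainder together with one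
  of \<open>a\<close>, \<open>b\<close>, \<open>c\<close>, and the polarized relation shows that it vanishes on three remainders. Therefore
  \<open>T\<close> only sees the projections to the span of \<open>a\<close>, \<open>b\<close>, \<open>c\<close>, where it is a determinant.
  Writing the result without division keeps the right-hand side polynomial in \<open>T\<close>.
\<close>

lemma eq_wedge_forms_of_contractions_decomposable:
  assumes T: "alternating_trilinear T" and rel: "contractions_decomposable T"
    and nz: "T a b c \<noteq> 0"
  shows "(T a b c)\<^sup>2 * T x y z =
    wedge_forms (\<lambda>x. T x b c) (\<lambda>x. T a x c) (\<lambda>x. T a b x) x y z"
proof -
  define \<tau> where "\<tau> = T a b c"
  define u v w where "u x = T x b c / \<tau>" and "v x = T a x c / \<tau>" and "w x = T a b x / \<tau>" for x
  define k where "k x = x - (u x *\<^sub>R a + v x *\<^sub>R b + w x *\<^sub>R c)" for x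
  note pol = contractions_polarized[OF T rel]
  note swap = alternating_trilinear_swap[OF T] and same = alternating_trilinear_repeated[OF T]
  note linear = alternating_trilinear_linear[OF T]
  note add1 = linear_add[OF linear(1)] and add2 = linear_add[OF linear(2)]
    and add3 = linear_add[OF linear(3)]
  note scale = linear_scale[OF linear(1)] linear_scale[OF linear(2)] linear_scale[OF linear(3)]
  note lin = add1 add2 add3 scale[unfolded real_scaleR_def]
  have x_eq: "x = (u x *\<^sub>R a + v x *\<^sub>R b + w x *\<^sub>R c) + k x" for x by (simp add: k_def)
  have k0: "T (k x) b c = 0" "T a (k x) c = 0" "T a b (k x) = 0" for x
  proof -
    define h where "h = k x"
    have "x = (u x *\<^sub>R a + v x *\<^sub>R b + w x *\<^sub>R c) + h" using x_eq h_def by simp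
    from arg_cong[OF this, of "\<lambda>x. T x b c"] arg_cong[OF this, of "\<lambda>x. T a x c"]
      arg_cong[OF this, of "\<lambda>x. T a b x"]
    have "T x b c = u x * T a b c + T h b c" "T a x c = v x * T a b c + T a h c"
      "T a b x = w x * T a b c + T a b h"
      unfolding lin same by linarith+
    moreover have "u x * T a b c = T x b c" "v x * T a b c = T a x c" "w x * T a b c = T a b x"
      using nz by (simp_all add: u_def v_def w_def \<tau>_def)
    ultimately have "T h b c = 0" "T a h c = 0" "T a b h = 0" by linarith+
    then show "T (k x) b c = 0" "T a (k x) c = 0" "T a b (k x) = 0" by (simp_all add: h_def)
  qed
  have cyc: "T x y z = T y z x" for x y z using swap(1)[of x y z] swap(2)[of y x z] by linarith
  \<comment> \<open>the relation for the contraction with \<open>d\<close>, in which all terms but \<open>T d e f * T d h y\<close> contain a vanishing factor\<close>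
  have contr0: "T d h y = 0"
    if "T d e f \<noteq> 0" "T d h f = 0" "T d e h = 0" for d e f h y
    using pol[of d e f d h y] that swap(2)[of d f h] by simp
  have ka: "T a (k x) y = 0" for x y
    using contr0[of a b c "k x" y] k0 nz by simp
  have kb: "T b (k x) y = 0" for x y
    using contr0[of b c a "k x" y] k0 nz cyc[of a b c] cyc[of a b "k x"] cyc[of "k x" b c] by simp
  have kc: "T c (k x) y = 0" for x y
    using contr0[of c a b "k x" y] k0 nz cyc[of c a b] cyc[of c a "k x"] cyc[of c "k x" b]
    by simp
  \<comment> \<open>in the polarized relation only \<open>T a b c * T (k x) (k y) (k z)\<close> survives\<close>
  have kkk: "T (k x) (k y) (k z) = 0" for x y z
  proof -
    have "T a b (k y) = 0" "T a c (k z) = 0" "T a b (k z) = 0" "T a c (k y) = 0"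
      using k0 swap(2)[of a c "k y"] swap(2)[of a c "k z"] by simp_all
    then show ?thesis using pol[of a b c "k x" "k y" "k z"] ka[of y "k z"] nz by simp
  qed
  have k1: "T (k x) y z = 0" for x y z
  proof -
    have k_abc: "T (k x) d z = 0" if "d = a \<or> d = b \<or> d = c" for d z x
      using that ka[of x z] kb[of x z] kc[of x z] swap(1)[of d "k x" z] by auto
    have "T (k x) y z = T (k x) (k y) z"
      by (subst x_eq[of y]) (simp add: lin k_abc)
    also have "\<dots> = T (k x) (k y) (k z)"
      by (subst x_eq[of z]) (simp add: lin k_abc swap(2)[of "k x" "k y"])
    finally show ?thesis by (simp add: kkk)
  qed
  have k2: "T x (k y) z = 0" for x y z using k1[of y x z] swap(1)[of x "k y" z] by simp
  have k3: "T x y (k z) = 0" for x y z using k2[of x z y] swap(2)[of x "k z" y] by simp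
  have perm: "T a c b = - \<tau>" "T b a c = - \<tau>" "T b c a = \<tau>" "T c a b = \<tau>" "T c b a = - \<tau>" "T a b c = \<tau>"
    using swap(2)[of a b c] swap(1)[of a b c] swap(2)[of b a c] swap(1)[of a c b] swap(2)[of c a b]
    unfolding \<tau>_def by auto
  have "T x y z = T (u x *\<^sub>R a + v x *\<^sub>R b + w x *\<^sub>R c) (u y *\<^sub>R a + v y *\<^sub>R b + w y *\<^sub>R c)
      (u z *\<^sub>R a + v z *\<^sub>R b + w z *\<^sub>R c)"
    by (subst x_eq[of x], subst x_eq[of y], subst x_eq[of z]) (simp only: add1 add2 add3 k1 k2 k3 add_0_right)
  also have "\<dots> = \<tau> * wedge_forms u v w x y z"
    unfolding lin same perm wedge_forms_def by (simp add: algebra_simps)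
  finally have "T x y z = \<tau> * wedge_forms u v w x y z" .
  moreover have "\<tau>\<^sup>2 * (\<tau> * wedge_forms u v w x y z) =
      wedge_forms (\<lambda>x. \<tau> * u x) (\<lambda>x. \<tau> * v x) (\<lambda>x. \<tau> * w x) x y z"
    unfolding wedge_forms_def by algebra
  moreover have "(\<lambda>x. \<tau> * u x) = (\<lambda>x. T x b c)" "(\<lambda>x. \<tau> * v x) = (\<lambda>x. T a x c)"
    "(\<lambda>x. \<tau> * w x) = (\<lambda>x. T a b x)"
    using nz by (auto simp: u_def v_def w_def \<tau>_def)
  ultimately show ?thesis unfolding \<tau>_def by simp
qed

text \<open>
  The product rule, arranged so that each summand keeps at least two of the three forms
  undifferentiated.
\<close>

lemma has_derivative_wedge_forms:
  assumes "(\<kappa> has_derivative \<kappa>') (at y0)" "\<And>i. (u i has_derivative u' i) (at y0)"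
    "\<And>i. (v i has_derivative v' i) (at y0)" "\<And>i. (w i has_derivative w' i) (at y0)"
  shows "((\<lambda>y. \<kappa> y * wedge_forms (\<lambda>i. u i y) (\<lambda>i. v i y) (\<lambda>i. w i y) i j k) has_derivative
    (\<lambda>h. \<kappa>' h * wedge_forms (\<lambda>i. u i y0) (\<lambda>i. v i y0) (\<lambda>i. w i y0) i j k +
      \<kappa> y0 * (wedge_forms (\<lambda>i. u' i h) (\<lambda>i. v i y0) (\<lambda>i. w i y0) i j k +
        wedge_forms (\<lambda>i. u i y0) (\<lambda>i. v' i h) (\<lambda>i. w i y0) i j k +
        wedge_forms (\<lambda>i. u i y0) (\<lambda>i. v i y0) (\<lambda>i. w' i h) i j k))) (at y0)"
  unfolding wedge_forms_def
  by (rule derivative_eq_intros assms refl)+ (simp add: algebra_simps)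

section \<open>Alternating sums over five indices\<close>

definition alternation5 :: "(nat \<Rightarrow> nat \<Rightarrow> nat \<Rightarrow> nat \<Rightarrow> nat \<Rightarrow> real) \<Rightarrow> real"
  where "alternation5 t = (\<Sum>\<sigma> | \<sigma> permutes {1..5}.
    of_int (sign \<sigma>) * t (\<sigma> 1) (\<sigma> 2) (\<sigma> 3) (\<sigma> 4) (\<sigma> 5))"

text \<open>
  Composition with a transposition permutes the permutations and reverses the sign.
\<close>

lemma sign_sum_transpose:
  assumes "i \<in> S" "j \<in> S" "i \<noteq> j" "finite S"
  shows "(\<Sum>\<sigma> | \<sigma> permutes S. of_int (sign \<sigma>) * t \<sigma> :: real) =
    - (\<Sum>\<sigma> | \<sigma> permutes S. of_int (sign \<sigma>) * t (\<sigma> \<circ> Transposition.transpose i j))"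
proof -
  have tr: "Transposition.transpose i j permutes S" using assms by (intro permutes_swap_id)
  have "sign (\<sigma> \<circ> Transposition.transpose i j) = - sign \<sigma>" if "\<sigma> permutes S" for \<sigma>
    using that assms permutation_permutes[of \<sigma>]
    by (subst sign_compose) (auto simp: permutation_swap_id sign_swap_id)
  then show ?thesis
    by (subst sum_permutations_compose_right[OF tr]) (simp add: sum_negf)
qed

lemma alternation5_add: "alternation5 (\<lambda>i j k l m. s i j k l m + t i j k l m) = alternation5 s + alternation5 t"
  by (simp add: alternation5_def distrib_left sum.distrib)

lemma alternation5_diff: "alternation5 (\<lambda>i j k l m. s i j k l m - t i j k l m) = alternation5 s - alternation5 t"
  by (simp add: alternation5_def right_diff_distrib sum_subtractf)

lemma alternation5_cmult: "alternation5 (\<lambda>i j k l m. r * t i j k l m) = r * alternation5 t"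
  by (simp add: alternation5_def sum_distrib_left mult.left_commute)

definition wedge5 where
  "wedge5 a b c d e = alternation5 (\<lambda>i j k l m. a i * b j * c k * d l * e m)"

lemma wedge5_repeated:
  "wedge5 a b a d e = 0" "wedge5 a b c a e = 0" "wedge5 a b c d a = 0"
  "wedge5 a b b d e = 0" "wedge5 a b c b e = 0" "wedge5 a b c d b = 0"
  "wedge5 a b c c e = 0" "wedge5 a b c d c = 0"
  using sign_sum_transpose[of 1 "{1..5::nat}" 3 "\<lambda>\<sigma>. a (\<sigma> 1) * b (\<sigma> 2) * a (\<sigma> 3) * d (\<sigma> 4) * e (\<sigma> 5)"]
    sign_sum_transpose[of 1 "{1..5::nat}" 4 "\<lambda>\<sigma>. a (\<sigma> 1) * b (\<sigma> 2) * c (\<sigma> 3) * a (\<sigma> 4) * e (\<sigma> 5)"]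
    sign_sum_transpose[of 1 "{1..5::nat}" 5 "\<lambda>\<sigma>. a (\<sigma> 1) * b (\<sigma> 2) * c (\<sigma> 3) * d (\<sigma> 4) * a (\<sigma> 5)"]
    sign_sum_transpose[of 2 "{1..5::nat}" 3 "\<lambda>\<sigma>. a (\<sigma> 1) * b (\<sigma> 2) * b (\<sigma> 3) * d (\<sigma> 4) * e (\<sigma> 5)"]
    sign_sum_transpose[of 2 "{1..5::nat}" 4 "\<lambda>\<sigma>. a (\<sigma> 1) * b (\<sigma> 2) * c (\<sigma> 3) * b (\<sigma> 4) * e (\<sigma> 5)"]
    sign_sum_transpose[of 2 "{1..5::nat}" 5 "\<lambda>\<sigma>. a (\<sigma> 1) * b (\<sigma> 2) * c (\<sigma> 3) * d (\<sigma> 4) * b (\<sigma> 5)"]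
    sign_sum_transpose[of 3 "{1..5::nat}" 4 "\<lambda>\<sigma>. a (\<sigma> 1) * b (\<sigma> 2) * c (\<sigma> 3) * c (\<sigma> 4) * e (\<sigma> 5)"]
    sign_sum_transpose[of 3 "{1..5::nat}" 5 "\<lambda>\<sigma>. a (\<sigma> 1) * b (\<sigma> 2) * c (\<sigma> 3) * d (\<sigma> 4) * c (\<sigma> 5)"]
  by (simp_all add: wedge5_def alternation5_def mult_ac)

text \<open>
  Expanding the wedge product of \<open>x\<close>, \<open>y\<close>, \<open>z\<close> gives six products of five factors, and each of them
  repeats \<open>p\<close> or \<open>q\<close>.
\<close>

lemma alternation5_wedge_forms:
  assumes "p \<in> {x, y, z} \<or> q \<in> {x, y, z}"
  shows "alternation5 (\<lambda>i j k l m. wedge_forms x y z i j k * (p l * q m)) = 0"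
proof -
  have "alternation5 (\<lambda>i j k l m. wedge_forms x y z i j k * (p l * q m)) =
      wedge5 x y z p q - wedge5 x z y p q - wedge5 y x z p q + wedge5 y z x p q +
      wedge5 z x y p q - wedge5 z y x p q"
    unfolding wedge5_def alternation5_add[symmetric] alternation5_diff[symmetric] wedge_forms_def
    by (simp add: algebra_simps)
  also have "\<dots> = 0" using assms by (auto simp: wedge5_repeated)
  finally show ?thesis .
qed

text \<open>
  Only quintuples that enumerate all five indices enter the sum.
\<close>

lemma alternation5_cong:
  assumes "\<And>i j k l m. {i, j, k, l, m} = {1..5} \<Longrightarrow> s i j k l m = t i j k l m"
  shows "alternation5 s = alternation5 t"
  unfolding alternation5_def
proof (rule sum.cong, rule refl)
  fix \<sigma> :: "nat \<Rightarrow> nat" assume "\<sigma> \<in> {\<sigma>. \<sigma> permutes {1..5}}"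
  then have im: "\<sigma> ` {1..5} = {1..5}" by (simp add: permutes_image)
  have "{\<sigma> 1, \<sigma> 2, \<sigma> 3, \<sigma> 4, \<sigma> 5} = \<sigma> ` {1, 2, 3, 4, 5}"
    by (simp only: image_insert image_empty)
  also have "{1, 2, 3, 4, 5} = {1..5::nat}" by auto
  also note im
  finally have "{\<sigma> 1, \<sigma> 2, \<sigma> 3, \<sigma> 4, \<sigma> 5} = {1..5}" .
  from assms[OF this] show "of_int (sign \<sigma>) * s (\<sigma> 1) (\<sigma> 2) (\<sigma> 3) (\<sigma> 4) (\<sigma> 5) =
      of_int (sign \<sigma>) * t (\<sigma> 1) (\<sigma> 2) (\<sigma> 3) (\<sigma> 4) (\<sigma> 5)"
    by (rule arg_cong)
qed

text \<open>
  The combinatorial core of the generalized Jacobi identity. Here \<open>D i j k h\<close> has the shape of the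
  derivative of \<open>\<kappa> (u \<and> v \<and> w)\<close> in direction \<open>h\<close>, evaluated on the differentials with numbers \<open>i\<close>,
  \<open>j\<close>, \<open>k\<close>. Each of its summands contains at least two of \<open>u\<close>, \<open>v\<close>, \<open>w\<close>, which must meet any two of them
  provided by the indices \<open>l\<close> and \<open>m\<close>.
\<close>

lemma alternation5_wedge_derivative:
  fixes u v w :: "nat \<Rightarrow> real" and u' v' w' :: "nat \<Rightarrow> 'h \<Rightarrow> real" and \<kappa>' :: "'h \<Rightarrow> real"
    and \<kappa> :: real
  defines "D \<equiv> \<lambda>i j k h. \<kappa>' h * wedge_forms u v w i j k +
    \<kappa> * (wedge_forms (\<lambda>i. u' i h) v w i j k + wedge_forms u (\<lambda>i. v' i h) w i j k +
      wedge_forms u v (\<lambda>i. w' i h) i j k)"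
  shows "alternation5 (\<lambda>i j k l m.
    D i j k h1 * (v l * w m - v m * w l) - D i j k h2 * (u l * w m - u m * w l) +
    D i j k h3 * (u l * v m - u m * v l)) = 0"
proof -
  have zero: "alternation5 (\<lambda>i j k l m. D i j k h * (p l * q m)) = 0"
    if "p \<in> {u, v, w}" "q \<in> {u, v, w}" "p \<noteq> q" for p q h
  proof -
    have "alternation5 (\<lambda>i j k l m. D i j k h * (p l * q m)) =
        \<kappa>' h * alternation5 (\<lambda>i j k l m. wedge_forms u v w i j k * (p l * q m)) +
        \<kappa> * (alternation5 (\<lambda>i j k l m. wedge_forms (\<lambda>i. u' i h) v w i j k * (p l * q m)) +
          alternation5 (\<lambda>i j k l m. wedge_forms u (\<lambda>i. v' i h) w i j k * (p l * q m)) +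
          alternation5 (\<lambda>i j k l m. wedge_forms u v (\<lambda>i. w' i h) i j k * (p l * q m)))"
      unfolding D_def alternation5_add[symmetric] alternation5_cmult[symmetric]
      by (simp only: distrib_right mult.assoc)
    also have "\<dots> = 0"
      using that by (subst (1 2 3 4) alternation5_wedge_forms) auto
    finally show ?thesis .
  qed
  have zero': "alternation5 (\<lambda>i j k l m. D i j k h * (p l * q m - p m * q l)) = 0"
    if "p \<in> {u, v, w}" "q \<in> {u, v, w}" for p q h
  proof (cases "p = q")
    case True
    then show ?thesis by (simp add: alternation5_def mult.commute)
  next
    case False
    have "alternation5 (\<lambda>i j k l m. D i j k h * (p l * q m - p m * q l)) =
        alternation5 (\<lambda>i j k l m. D i j k h * (p l * q m)) -
        alternation5 (\<lambda>i j k l m. D i j k h * (q l * p m))"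
      unfolding alternation5_diff[symmetric] by (simp only: right_diff_distrib mult.commute[of "p _" "q _"])
    then show ?thesis using zero[OF that False] zero[OF that(2,1)] False by simp
  qed
  show ?thesis
    by (simp only: alternation5_add alternation5_diff zero' insertI1 insertI2 add_0_right diff_self)
qed

text \<open>
  With the first index pinned to 1, the 24 permutations of the remaining indices fall into the three
  ways to form two pairs, each of which is counted eight times.
\<close>

lemma alternation5_pairs:
  fixes M :: "nat \<Rightarrow> nat \<Rightarrow> real"
  assumes anti: "\<And>i j. M i j = - M j i"
  shows "alternation5 (\<lambda>i j k l m. of_bool (i = 1) * M j k * M l m) =
    8 * (M 2 3 * M 4 5 - M 2 4 * M 3 5 + M 2 5 * M 3 4)"
proof -
  have S: "{1..5::nat} = insert 1 (insert 2 (insert 3 (insert 4 {5})))" by auto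
  have anti': "M 3 2 = - M 2 3" "M 4 2 = - M 2 4" "M 5 2 = - M 2 5"
    "M 4 3 = - M 3 4" "M 5 3 = - M 3 5" "M 5 4 = - M 4 5" by (rule anti)+
  have fin: "finite (insert 2 (insert 3 (insert 4 {5::nat})))" "1 \<notin> insert 2 (insert 3 (insert 4 {5::nat}))"
    "finite (insert 3 (insert 4 {5::nat}))" "2 \<notin> insert 3 (insert 4 {5::nat})"
    "finite (insert 4 {5::nat})" "3 \<notin> insert 4 {5::nat}"
    "finite {5::nat}" "4 \<notin> {5::nat}" by auto
  show ?thesis
    unfolding alternation5_def S
    unfolding sum_over_permutations_insert[OF fin(1,2)]
    unfolding sum_over_permutations_insert[OF fin(3,4)]
    unfolding sum_over_permutations_insert[OF fin(5,6)]
    unfolding sum_over_permutations_insert[OF fin(7,8)]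
    unfolding permutes_sing
    by (simp add: sign_swap_id permutation_swap_id permutation_compose sign_compose sign_id
        swap_id_eq anti' algebra_simps)
qed

text \<open>
  The bracketed expression is the wedge product of the indicator of the index 1 with the 2-form \<open>M\<close>;
  transposing indices reduces each of its summands to the first one.
\<close>

lemma alternation5_derivation:
  fixes M :: "nat \<Rightarrow> nat \<Rightarrow> real"
  assumes anti: "\<And>i j. M i j = - M j i"
  shows "alternation5 (\<lambda>i j k l m. (of_bool (i = 1) * M j k - of_bool (j = 1) * M i k
      + of_bool (k = 1) * M i j) * M l m) =
    24 * (M 2 3 * M 4 5 - M 2 4 * M 3 5 + M 2 5 * M 3 4)"
proof -
  let ?s = "alternation5 (\<lambda>i j k l m. of_bool (i = 1) * M j k * M l m)"
  have 2: "alternation5 (\<lambda>i j k l m. of_bool (j = 1) * M i k * M l m) = - ?s"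
    unfolding alternation5_def by (subst sign_sum_transpose[of 1 _ 2]) simp_all
  have flip: "of_bool (i = 1) * M k j * M l m = (-1) * (of_bool (i = 1) * M j k * M l m)"
    for i j k l m :: nat
    using anti[of k j] by simp
  have "alternation5 (\<lambda>i j k l m. of_bool (k = 1) * M i j * M l m) =
      - alternation5 (\<lambda>i j k l m. of_bool (i = 1) * M k j * M l m)"
    unfolding alternation5_def by (subst sign_sum_transpose[of 1 _ 3]) simp_all
  also have "alternation5 (\<lambda>i j k l m. of_bool (i = 1) * M k j * M l m) =
      alternation5 (\<lambda>i j k l m. (-1) * (of_bool (i = 1) * M j k * M l m))"
    by (rule arg_cong[of _ _ alternation5], intro ext, rule flip)
  also have "- alternation5 (\<lambda>i j k l m. (-1) * (of_bool (i = 1) * M j k * M l m)) = ?s"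
    unfolding alternation5_cmult by simp
  finally have 3: "alternation5 (\<lambda>i j k l m. of_bool (k = 1) * M i j * M l m) = ?s" .
  have "alternation5 (\<lambda>i j k l m. (of_bool (i = 1) * M j k - of_bool (j = 1) * M i k
      + of_bool (k = 1) * M i j) * M l m) = ?s -
      alternation5 (\<lambda>i j k l m. of_bool (j = 1) * M i k * M l m) +
      alternation5 (\<lambda>i j k l m. of_bool (k = 1) * M i j * M l m)"
    by (simp only: distrib_right left_diff_distrib alternation5_add alternation5_diff)
  also have "\<dots> = 3 * ?s" unfolding 2 3 by simp
  finally show ?thesis using alternation5_pairs[of M, OF anti] by simp
qed

section \<open>Charts, tangent vectors and covectors\<close>

text \<open>
  The coordinates of the differential in a fixed frame. The name is justified by \<open>inner_gradient\<close>.
\<close>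

definition gradient :: "'a::real_inner set \<Rightarrow> ('a \<Rightarrow> real) \<Rightarrow> 'a \<Rightarrow> 'a"
  where "gradient E F y = (\<Sum>e\<in>E. frechet_derivative F (at y) e *\<^sub>R e)"

lemma inner_gradient:
  assumes "Parseval_frame E" "F differentiable (at y)"
  shows "gradient E F y \<bullet> h = frechet_derivative F (at y) h"
  unfolding gradient_def
  by (rule linear_functional_eq_inner[OF assms(1) linear_frechet_derivative[OF assms(2)], symmetric])

lemma gradient_eqI:
  assumes "Parseval_frame E" "(F has_derivative (\<lambda>h. g \<bullet> h)) (at y)"
  shows "gradient E F y = g"
  using assms(1) unfolding gradient_def frechet_derivative_at[OF assms(2), symmetric] Parseval_frame_def
  by simp

text \<open>
  A frame of the model space is fixed once and for all; it exists by \<open>Parseval_frame_exists\<close>.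
\<close>

locale framed_manifold =
  fixes X :: "'m topology" and A :: "('m, 'e::real_inner) chart set" and E :: "'e set"
  assumes manifold: "smooth_manifold X A" and frame: "Parseval_frame E"
begin

lemma chart:
  assumes "(U, \<phi>) \<in> A"
  shows "openin X U" "open (\<phi> ` U)"
    "homeomorphic_map (subtopology X U) (top_of_set (\<phi> ` U)) \<phi>"
proof -
  have "\<forall>(U, \<phi>)\<in>A. openin X U \<and> open (\<phi> ` U) \<and>
       homeomorphic_map (subtopology X U) (top_of_set (\<phi> ` U)) \<phi>"
    using manifold unfolding smooth_manifold_def by (elim conjE) assumption
  then show "openin X U" "open (\<phi> ` U)"
    "homeomorphic_map (subtopology X U) (top_of_set (\<phi> ` U)) \<phi>"
    using assms by blast+
qed

lemma chart_subset: "(U, \<phi>) \<in> A \<Longrightarrow> U \<subseteq> topspace X"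
  using chart(1) openin_subset by blast

lemma chart_inj: "(U, \<phi>) \<in> A \<Longrightarrow> inj_on \<phi> U"
  using homeomorphic_imp_injective_map[OF chart(3)] chart_subset
  by (metis topspace_subtopology_subset)

lemma chart_inv [simp]: "(U, \<phi>) \<in> A \<Longrightarrow> q \<in> U \<Longrightarrow> inv_into U \<phi> (\<phi> q) = q"
  by (simp add: chart_inj inv_into_f_f)

lemma open_chart_image:
  assumes "(U, \<phi>) \<in> A" "openin X W"
  shows "open (\<phi> ` (U \<inter> W))"
proof -
  have "openin (subtopology X U) (U \<inter> W)"
    using assms(2) by (simp add: openin_subtopology_Int2)
  then have "openin (top_of_set (\<phi> ` U)) (\<phi> ` (U \<inter> W))"
    using homeomorphic_imp_open_map[OF chart(3)[OF assms(1)]] by (simp add: open_map_def)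
  then show ?thesis using chart(2)[OF assms(1)] by (rule openin_open_trans)
qed

lemma open_chart_overlap:
  "(U, \<phi>) \<in> A \<Longrightarrow> (V, \<psi>) \<in> A \<Longrightarrow> open (\<phi> ` (U \<inter> V))"
  by (rule open_chart_image[OF _ chart(1)])

lemma covered:
  assumes "p \<in> topspace X"
  obtains U \<phi> where "(U, \<phi>) \<in> A" "p \<in> U"
proof -
  have "(\<Union>(U, \<phi>)\<in>A. U) = topspace X" using manifold unfolding smooth_manifold_def by (elim conjE) assumption
  then have "p \<in> (\<Union>(U, \<phi>)\<in>A. U)" using assms by simp
  then show ?thesis using that by blast
qed

lemma transition_smooth:
  assumes "(U, \<phi>) \<in> A" "(V, \<psi>) \<in> A"
  shows "Ck_on k (\<phi> ` (U \<inter> V)) (\<psi> \<circ> inv_into U \<phi>)"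
proof -
  have "\<forall>(U, \<phi>)\<in>A. \<forall>(V, \<psi>)\<in>A. smooth_on (\<phi> ` (U \<inter> V)) (\<psi> \<circ> inv_into U \<phi>)"
    using manifold unfolding smooth_manifold_def by (elim conjE) assumption
  then show ?thesis using assms unfolding smooth_on_def by blast
qed

lemma transition_differentiable:
  assumes "(U, \<phi>) \<in> A" "(V, \<psi>) \<in> A" "p \<in> U" "p \<in> V"
  shows "(\<psi> \<circ> inv_into U \<phi>) differentiable (at (\<phi> p))"
  using transition_smooth[OF assms(1,2), of "Suc 0"] assms(3,4) by auto

text \<open>
  Near \<open>\<psi> p\<close>, the function in the chart \<open>\<psi>\<close> is the function in the chart \<open>\<phi>\<close> composed with the
  transition map, so the chain rule applies. The codomain of \<open>f\<close> is left general in order to cover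
  coordinate maps as well as real functions.
\<close>

lemma coordinate_change:
  assumes c: "(U, \<phi>) \<in> A" and d: "(V, \<psi>) \<in> A" and p: "p \<in> U" "p \<in> V"
    and f: "(f \<circ> inv_into U \<phi>) differentiable (at (\<phi> p))"
  shows "(f \<circ> inv_into V \<psi>) differentiable (at (\<psi> p))"
    and "frechet_derivative (f \<circ> inv_into V \<psi>) (at (\<psi> p)) h =
      frechet_derivative (f \<circ> inv_into U \<phi>) (at (\<phi> p))
        (frechet_derivative (\<phi> \<circ> inv_into V \<psi>) (at (\<psi> p)) h)"
proof -
  let ?g = "(f \<circ> inv_into U \<phi>) \<circ> (\<phi> \<circ> inv_into V \<psi>)"
  have tr: "(\<phi> \<circ> inv_into V \<psi>) differentiable (at (\<psi> p))"
    by (rule transition_differentiable[OF d c p(2,1)])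
  have at: "(\<phi> \<circ> inv_into V \<psi>) (\<psi> p) = \<phi> p" using d p by simp
  have eq: "?g y = (f \<circ> inv_into V \<psi>) y" if "y \<in> \<psi> ` (V \<inter> U)" for y
    using that c d by auto
  have g: "?g differentiable (at (\<psi> p))"
    by (rule differentiable_chain_at[OF tr]) (unfold at, rule f)
  have S: "open (\<psi> ` (V \<inter> U))" "\<psi> p \<in> \<psi> ` (V \<inter> U)"
    using open_chart_overlap[OF d c] p by auto
  show "(f \<circ> inv_into V \<psi>) differentiable (at (\<psi> p))"
    using g eq S unfolding differentiable_def
    by (meson has_derivative_transform_within_open)
  have "frechet_derivative (f \<circ> inv_into V \<psi>) (at (\<psi> p)) = frechet_derivative ?g (at (\<psi> p))"
    by (rule frechet_derivative_transform_within_open[OF g S eq, symmetric])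
  also have "\<dots> = frechet_derivative (f \<circ> inv_into U \<phi>) (at ((\<phi> \<circ> inv_into V \<psi>) (\<psi> p))) \<circ>
      frechet_derivative (\<phi> \<circ> inv_into V \<psi>) (at (\<psi> p))"
    by (rule frechet_derivative_compose[OF tr]) (unfold at, rule f)
  finally show "frechet_derivative (f \<circ> inv_into V \<psi>) (at (\<psi> p)) h =
      frechet_derivative (f \<circ> inv_into U \<phi>) (at (\<phi> p))
        (frechet_derivative (\<phi> \<circ> inv_into V \<psi>) (at (\<psi> p)) h)"
    unfolding at by simp
qed

lemma tangent_transition:
  assumes "v \<in> tangent_space A p" "(U, \<phi>) \<in> A" "(V, \<psi>) \<in> A" "p \<in> U" "p \<in> V"
  shows "v (V, \<psi>) = frechet_derivative (\<psi> \<circ> inv_into U \<phi>) (at (\<phi> p)) (v (U, \<phi>))"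
  using assms unfolding tangent_space_def by fast

lemma subspace_tangent: "subspace (tangent_space A p)"
  by (rule subspace_tangent_space[OF manifold])

text \<open>
  A coordinate vector \<open>h\<close> in one chart is transported to all other charts by the derivatives of the
  transition maps; the chain rule makes the resulting family consistent.
\<close>

lemma tangent_vector_exists:
  assumes c: "(U, \<phi>) \<in> A" and p: "p \<in> U"
  obtains v where "v \<in> tangent_space A p" "v (U, \<phi>) = h"
proof
  define v where "v c = (if c \<in> A \<and> p \<in> fst c
    then frechet_derivative (snd c \<circ> inv_into U \<phi>) (at (\<phi> p)) h else 0)" for c
  have "v (W, \<omega>) = frechet_derivative (\<omega> \<circ> inv_into V \<psi>) (at (\<psi> p)) (v (V, \<psi>))"
    if "(V, \<psi>) \<in> A" "(W, \<omega>) \<in> A" "p \<in> V" "p \<in> W" for V \<psi> W \<omega>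
    using coordinate_change(2)[OF that(1) c that(3) p transition_differentiable[OF that], of h] that
    by (simp add: v_def)
  then have "\<forall>(V, \<psi>)\<in>A. \<forall>(W, \<omega>)\<in>A. p \<in> V \<inter> W \<longrightarrow>
      v (W, \<omega>) = frechet_derivative (\<omega> \<circ> inv_into V \<psi>) (at (\<psi> p)) (v (V, \<psi>))"
    by blast
  moreover have "\<forall>c. \<not> (c \<in> A \<and> p \<in> fst c) \<longrightarrow> v c = 0" by (simp add: v_def)
  ultimately show "v \<in> tangent_space A p" unfolding tangent_space_def by blast
  have "((\<lambda>y. y) has_derivative (\<lambda>h. h)) (at (\<phi> p))" by (rule has_derivative_ident)
  then have "((\<phi> \<circ> inv_into U \<phi>) has_derivative (\<lambda>h. h)) (at (\<phi> p))"
    by (rule has_derivative_transform_within_open[OF _ chart(2)[OF c]]) (use p c in auto)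
  from frechet_derivative_at[OF this] show "v (U, \<phi>) = h"
    using c p by (simp add: v_def fun_eq_iff del: comp_apply)
qed

text \<open>
  The covector at \<open>p\<close> whose coordinate vector in the chart \<open>c\<close> is \<open>a\<close>.
\<close>

definition covector :: "('m, 'e) chart \<Rightarrow> 'm \<Rightarrow> 'e \<Rightarrow> (('m, 'e) chart \<Rightarrow> 'e) \<Rightarrow> real"
  where "covector c p a = (\<lambda>v. if v \<in> tangent_space A p then a \<bullet> v c else 0)"

lemma covector_add: "covector c p (a + b) = covector c p a + covector c p b"
  by (auto simp: covector_def inner_add_left)

lemma covector_scale: "covector c p (r *\<^sub>R a) = r *\<^sub>R covector c p a"
  by (auto simp: covector_def)

lemma covector_in_dual: "covector c p a \<in> dual_space (tangent_space A p)"
  using subspace_tangent[of p]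
  by (auto simp: covector_def dual_space_def subspace_add subspace_scale inner_add_right)

text \<open>
  Evaluation in the chart is a linear isomorphism from the tangent space to the model space, where
  linear functionals are inner products.
\<close>

lemma dual_eq_covector:
  assumes c: "(U, \<phi>) \<in> A" and p: "p \<in> U" and \<alpha>: "\<alpha> \<in> dual_space (tangent_space A p)"
  obtains a where "\<alpha> = covector (U, \<phi>) p a"
proof -
  let ?T = "tangent_space A p"
  have inj: "v = w" if "v \<in> ?T" "w \<in> ?T" "v (U, \<phi>) = w (U, \<phi>)" for v w
  proof
    fix d :: "('m, 'e) chart"
    obtain V \<psi> where d: "d = (V, \<psi>)" by (cases d)
    show "v d = w d"
    proof (cases "d \<in> A \<and> p \<in> fst d")
      case True
      then have V: "(V, \<psi>) \<in> A" "p \<in> V" by (simp_all add: d)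
      show ?thesis
        unfolding d tangent_transition[OF that(1) c V(1) p V(2)]
          tangent_transition[OF that(2) c V(1) p V(2)] that(3) ..
    next
      case False
      have "v d = 0" "w d = 0"
        using that(1)[unfolded tangent_space_def mem_Collect_eq, THEN conjunct1, rule_format, OF False]
          that(2)[unfolded tangent_space_def mem_Collect_eq, THEN conjunct1, rule_format, OF False]
        by this
      then show ?thesis by simp
    qed
  qed
  have "\<forall>h. \<exists>v. v \<in> ?T \<and> v (U, \<phi>) = h"
  proof
    fix h
    show "\<exists>v. v \<in> ?T \<and> v (U, \<phi>) = h" by (rule tangent_vector_exists[OF c p, of h]) blast
  qed
  from choice[OF this] obtain s where s: "s h \<in> ?T" "s h (U, \<phi>) = h" for h by blast
  have add: "s (h + k) = s h + s k" for h k
    by (rule inj) (simp_all add: s subspace_add[OF subspace_tangent])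
  have scale: "s (r *\<^sub>R h) = r *\<^sub>R s h" for r h
    by (rule inj) (simp_all add: s subspace_scale[OF subspace_tangent])
  have "linear (\<lambda>h. \<alpha> (s h))"
    using \<alpha> s by (intro linearI) (auto simp: add scale dual_space_def)
  from linear_functional_eq_inner[OF frame this]
  have "\<alpha> (s h) = (\<Sum>e\<in>E. \<alpha> (s e) *\<^sub>R e) \<bullet> h" for h .
  moreover have "v = s (v (U, \<phi>))" if "v \<in> ?T" for v by (rule inj) (simp_all add: that s)
  ultimately have "\<alpha> v = (\<Sum>e\<in>E. \<alpha> (s e) *\<^sub>R e) \<bullet> v (U, \<phi>)" if "v \<in> ?T" for v
    using that by metis
  then have "\<alpha> = covector (U, \<phi>) p (\<Sum>e\<in>E. \<alpha> (s e) *\<^sub>R e)"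
    using \<alpha> by (auto simp: covector_def dual_space_def)
  then show ?thesis by (rule that)
qed

text \<open>
  The differential is defined by means of an unspecified chart around \<open>p\<close>; here it is computed in
  any given one.
\<close>

lemma differential_eq_covector:
  assumes c: "(U, \<phi>) \<in> A" and p: "p \<in> U"
    and f: "(f \<circ> inv_into U \<phi>) differentiable (at (\<phi> p))"
  shows "differential A f p = covector (U, \<phi>) p (gradient E (f \<circ> inv_into U \<phi>) (\<phi> p))"
proof
  fix v
  show "differential A f p v = covector (U, \<phi>) p (gradient E (f \<circ> inv_into U \<phi>) (\<phi> p)) v"
  proof (cases "v \<in> tangent_space A p")
    case True
    define d where "d = (SOME c. c \<in> A \<and> p \<in> fst c)"
    have "d \<in> A \<and> p \<in> fst d" unfolding d_def by (rule someI[of "\<lambda>c. c \<in> A \<and> p \<in> fst c" "(U, \<phi>)"]) (use c p in simp)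
    then obtain V \<psi> where d: "d = (V, \<psi>)" "(V, \<psi>) \<in> A" "p \<in> V" by (cases d) auto
    have "differential A f p v = frechet_derivative (f \<circ> inv_into V \<psi>) (at (\<psi> p)) (v (V, \<psi>))"
      using True d(1) unfolding differential_def d_def[symmetric] Let_def by simp
    also have "\<dots> = frechet_derivative (f \<circ> inv_into U \<phi>) (at (\<phi> p)) (v (U, \<phi>))"
      unfolding coordinate_change(2)[OF c d(2) p d(3) f]
      by (simp only: tangent_transition[OF True d(2) c d(3) p])
    finally show ?thesis using True by (simp add: covector_def inner_gradient[OF frame f])
  qed (simp add: differential_def covector_def)
qed

lemma differential_coordinate:
  assumes c: "(U, \<phi>) \<in> A" and p: "p \<in> U"
  shows "differential A (\<lambda>q. a \<bullet> \<phi> q) p = covector (U, \<phi>) p a"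
proof -
  have "((\<lambda>y. a \<bullet> y) has_derivative (\<lambda>h. a \<bullet> h)) (at (\<phi> p))"
    by (auto intro!: derivative_eq_intros)
  then have D: "(((\<lambda>q. a \<bullet> \<phi> q) \<circ> inv_into U \<phi>) has_derivative (\<lambda>h. a \<bullet> h)) (at (\<phi> p))"
    by (rule has_derivative_transform_within_open[OF _ chart(2)[OF c]]) (use p c in auto)
  show ?thesis
    using differential_eq_covector[OF c p, of "\<lambda>q. a \<bullet> \<phi> q"] D
    unfolding gradient_eqI[OF frame D] by (auto simp: differentiable_def)
qed

text \<open>
  Multiplying with a bump function supported in the coordinate domain and extending by 0 makes a
  function of the coordinates global without changing it near \<open>\<phi> p\<close>. The extension is smooth because
  the support is compact, hence closed in the Hausdorff space \<open>X\<close>: every other coordinate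
  domain is covered by its intersections with \<open>U\<close> and with the complement of the support. The set
  \<open>S\<close> does not depend on \<open>Q\<close>, so that several functions can be treated at once.
\<close>

lemma cutoff:
  assumes c: "(U, \<phi>) \<in> A" and p: "p \<in> U"
  obtains S where "open S" "\<phi> p \<in> S" "S \<subseteq> \<phi> ` U"
    "\<And>Q :: 'e \<Rightarrow> real. (\<And>k. Ck_on k UNIV Q) \<Longrightarrow>
      \<exists>f. smooth_fun A f \<and> (\<forall>y\<in>S. (f \<circ> inv_into U \<phi>) y = Q y)"
proof -
  obtain r where r: "r > 0" "cball (\<phi> p) r \<subseteq> \<phi> ` U"
    using open_contains_cball[of "\<phi> ` U"] chart(2)[OF c] p by auto
  obtain \<rho> :: "'e \<Rightarrow> real" and \<delta> where \<rho>: "\<And>k. Ck_on k UNIV \<rho>" "\<delta> > 0"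
    "\<And>x. x \<in> ball (\<phi> p) \<delta> \<Longrightarrow> \<rho> x = 1" "\<And>x. x \<notin> cball (\<phi> p) r \<Longrightarrow> \<rho> x = 0"
    using smooth_bump[OF r(1)] by metis
  define K where "K = U \<inter> \<phi> -` cball (\<phi> p) r"
  have "\<phi> ` K = cball (\<phi> p) r" using r(2) by (auto simp: K_def)
  moreover have "compact (cball (\<phi> p) r)" by (rule compact_cball_frame[OF frame])
  ultimately have "compactin (top_of_set (\<phi> ` U)) (\<phi> ` K)"
    using r(2) by (simp add: compactin_subtopology)
  then have "compactin (subtopology X U) K"
    using homeomorphic_map_compactness[OF chart(3)[OF c], of K] chart_subset[OF c]
    by (auto simp: K_def)
  then have "compactin X K" by (simp add: compactin_subtopology)
  moreover have "Hausdorff_space X" using manifold by (simp add: smooth_manifold_def)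
  ultimately have "closedin X K" by (simp add: compactin_imp_closedin)
  then have openK: "openin X (topspace X - K)" by blast
  have "\<exists>f. smooth_fun A f \<and> (\<forall>y\<in>ball (\<phi> p) (min r \<delta>). (f \<circ> inv_into U \<phi>) y = Q y)"
    if Q: "\<And>k. Ck_on k UNIV Q" for Q :: "'e \<Rightarrow> real"
  proof -
    define g where "g y = \<rho> y * Q y" for y
    define f where "f q = (if q \<in> U then g (\<phi> q) else 0)" for q
    have Ck_g: "Ck_on k UNIV g" for k
      unfolding g_def by (intro Ck_on_mult Q \<rho>) simp
    have "smooth_on (\<psi> ` V) (f \<circ> inv_into V \<psi>)" if d: "(V, \<psi>) \<in> A" for V \<psi>
      unfolding smooth_on_def
    proof
      fix k
      have V: "\<psi> ` V = \<psi> ` (V \<inter> U) \<union> \<psi> ` (V \<inter> (topspace X - K))"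
        using chart_subset[OF d] by (auto simp: K_def)
      have "Ck_on k (\<psi> ` (V \<inter> U)) (g \<circ> (\<phi> \<circ> inv_into V \<psi>))"
        by (rule Ck_on_compose[OF frame open_chart_overlap[OF d c] subset_UNIV
              transition_smooth[OF d c] Ck_g])
      then have 1: "Ck_on k (\<psi> ` (V \<inter> U)) (f \<circ> inv_into V \<psi>)"
        by (rule Ck_on_cong[OF open_chart_overlap[OF d c], rotated]) (auto simp: f_def d)
      have zero: "0 = (f \<circ> inv_into V \<psi>) y" if yK: "y \<in> \<psi> ` (V \<inter> (topspace X - K))" for y
      proof -
        obtain q where q: "q \<in> V" "q \<notin> K" "y = \<psi> q" using yK by blast
        show ?thesis
        proof (cases "q \<in> U")
          case True
          then have "\<phi> q \<notin> cball (\<phi> p) r" using q(2) unfolding K_def by blast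
          then show ?thesis using \<rho>(4) q d by (simp add: f_def g_def)
        qed (use q d in \<open>simp add: f_def\<close>)
      qed
      have 2: "Ck_on k (\<psi> ` (V \<inter> (topspace X - K))) (f \<circ> inv_into V \<psi>)"
        by (rule Ck_on_cong[where f = "\<lambda>_. 0", OF open_chart_image[OF d openK] zero Ck_on_const])
      show "Ck_on k (\<psi> ` V) (f \<circ> inv_into V \<psi>)"
        unfolding V
        by (rule Ck_on_Un[OF open_chart_overlap[OF d c] open_chart_image[OF d openK] 1 2])
    qed
    then have "smooth_fun A f" unfolding smooth_fun_def by fast
    moreover have "(f \<circ> inv_into U \<phi>) y = Q y" if "y \<in> ball (\<phi> p) (min r \<delta>)" for y
    proof -
      have "y \<in> \<phi> ` U" using that r(2) by auto
      then obtain q where "q \<in> U" "y = \<phi> q" by auto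
      then show ?thesis using c that by (simp add: f_def g_def \<rho>(3))
    qed
    ultimately show ?thesis by blast
  qed
  moreover have "ball (\<phi> p) (min r \<delta>) \<subseteq> \<phi> ` U" using r(2) by auto
  ultimately show ?thesis using that[of "ball (\<phi> p) (min r \<delta>)"] r(1) \<rho>(2) by simp
qed

end

section \<open>The components of a 3-vector field\<close>

locale trivector_manifold = framed_manifold X A E
  for X :: "'m topology" and A :: "('m, 'e::real_inner) chart set" and E :: "'e set" +
  fixes P :: "'m \<Rightarrow> (('m, 'e) chart \<Rightarrow> 'e) trivector"
  assumes field: "trivector_field X A P"
begin

definition components :: "('m, 'e) chart \<Rightarrow> 'm \<Rightarrow> 'e \<Rightarrow> 'e \<Rightarrow> 'e \<Rightarrow> real"
  where "components c p x y z = P p (covector c p x) (covector c p y) (covector c p z)"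

lemma exterior: "p \<in> topspace X \<Longrightarrow> P p \<in> exterior_cube (tangent_space A p)"
  using field unfolding trivector_field_def by blast

lemma alternating_components:
  assumes "p \<in> topspace X"
  shows "alternating_trilinear (components c p)"
proof -
  note ext = exterior[OF assms, unfolded exterior_cube_def mem_Collect_eq]
  note mem = covector_in_dual[of c p]
  have 1: "components c p (x + x') y z = components c p x y z + components c p x' y z" for x x' y z
    unfolding components_def covector_add using ext mem by blast
  have 2: "components c p (r *\<^sub>R x) y z = r *\<^sub>R components c p x y z" for r x y z
    unfolding components_def covector_scale real_scaleR_def using ext mem by blast
  have 3: "components c p y x z = - components c p x y z \<and>
      components c p x z y = - components c p x y z" for x y z
    unfolding components_def using ext mem by blast
  have "linear (\<lambda>x. components c p x y z)" for y z by (rule linearI) (rule 1, rule 2)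
  with 3 show ?thesis unfolding alternating_trilinear_def by blast
qed

lemma wedge3_covector:
  "wedge3 (tangent_space A p) u v w (covector c p x) (covector c p y) (covector c p z) =
    wedge_forms (\<lambda>a. covector c p a u) (\<lambda>a. covector c p a v) (\<lambda>a. covector c p a w) x y z"
  by (simp add: wedge3_def covector_in_dual det_3 wedge_forms_def algebra_simps)

text \<open>
  The linear forms in a factorization of the component form are represented by tangent vectors
  through the inner product, and conversely.
\<close>

lemma decomposable3_iff:
  assumes c: "(U, \<phi>) \<in> A" and p: "p \<in> U"
  shows "decomposable3 (tangent_space A p) (P p) \<longleftrightarrow>
    contractions_decomposable (components (U, \<phi>) p)"
proof
  assume "decomposable3 (tangent_space A p) (P p)"
  then obtain u v w where "P p = wedge3 (tangent_space A p) u v w"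
    unfolding decomposable3_def by blast
  then have "components (U, \<phi>) p = wedge_forms (\<lambda>a. covector (U, \<phi>) p a u)
      (\<lambda>a. covector (U, \<phi>) p a v) (\<lambda>a. covector (U, \<phi>) p a w)"
    by (intro ext) (simp only: components_def wedge3_covector)
  then show "contractions_decomposable (components (U, \<phi>) p)"
    using contractions_decomposable_wedge_forms by simp
next
  let ?T = "tangent_space A p" and ?C = "components (U, \<phi>) p"
  assume rel: "contractions_decomposable ?C"
  have pX: "p \<in> topspace X" using chart_subset[OF c] p by blast
  note alt = alternating_components[OF pX, of "(U, \<phi>)"]
  note lin = alternating_trilinear_linear[OF alt]
  have represent: "\<exists>v\<in>?T. \<forall>a. covector (U, \<phi>) p a v = f a" if "linear f" for f :: "'e \<Rightarrow> real"
  proof -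
    obtain v where v: "v \<in> ?T" "v (U, \<phi>) = (\<Sum>e\<in>E. f e *\<^sub>R e)"
      by (rule tangent_vector_exists[OF c p])
    have "covector (U, \<phi>) p a v = f a" for a
      unfolding linear_functional_eq_inner[OF frame that, of a] using v
      by (simp add: covector_def inner_commute)
    then show ?thesis using v(1) by blast
  qed
  have "\<exists>u v w. linear u \<and> linear v \<and> linear w \<and> ?C = wedge_forms u v w"
  proof (cases "\<exists>a b d. ?C a b d \<noteq> 0")
    case True
    then obtain a b d where nz: "?C a b d \<noteq> 0" by blast
    define \<tau> where "\<tau> = ?C a b d"
    \<comment> \<open>the factor \<open>1 / \<tau>\<^sup>2\<close> is absorbed into the first form\<close>
    have "?C x y z = wedge_forms (\<lambda>x. inverse (\<tau>\<^sup>2) *\<^sub>R ?C x b d) (\<lambda>x. ?C a x d) (\<lambda>x. ?C a b x) x y z"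
      for x y z
    proof -
      have *: "wedge_forms (\<lambda>x. r *\<^sub>R f x) g h x y z = r * wedge_forms f g h x y z"
        for r and f g h :: "'e \<Rightarrow> real"
        by (simp add: wedge_forms_def algebra_simps)
      have "\<tau>\<^sup>2 \<noteq> 0" using nz by (simp add: \<tau>_def)
      then have "?C x y z = inverse (\<tau>\<^sup>2) * (\<tau>\<^sup>2 * ?C x y z)"
        by (simp flip: mult.assoc)
      then show ?thesis
        unfolding * \<tau>_def by (simp only: eq_wedge_forms_of_contractions_decomposable[OF alt rel nz])
    qed
    then have "?C = wedge_forms (\<lambda>x. inverse (\<tau>\<^sup>2) *\<^sub>R ?C x b d) (\<lambda>x. ?C a x d) (\<lambda>x. ?C a b x)"
      by (intro ext)
    with linear_compose_scale_right[OF lin(1)] lin(2,3) show ?thesis by (intro exI conjI)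
  next
    case False
    then have "?C = wedge_forms (\<lambda>_. 0) (\<lambda>_. 0) (\<lambda>_. 0)"
      by (auto simp: wedge_forms_def fun_eq_iff)
    with linear_zero linear_zero linear_zero show ?thesis by (intro exI conjI)
  qed
  then obtain f g h where fgh: "linear f" "linear g" "linear h" "?C = wedge_forms f g h" by blast
  from represent[OF fgh(1)] represent[OF fgh(2)] represent[OF fgh(3)]
  obtain u v w where uvw: "u \<in> ?T" "v \<in> ?T" "w \<in> ?T"
    "(\<lambda>a. covector (U, \<phi>) p a u) = f" "(\<lambda>a. covector (U, \<phi>) p a v) = g"
    "(\<lambda>a. covector (U, \<phi>) p a w) = h" by (auto simp: fun_eq_iff)
  have "P p \<alpha> \<beta> \<gamma> = wedge3 ?T u v w \<alpha> \<beta> \<gamma>" for \<alpha> \<beta> \<gamma>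
  proof (cases "\<alpha> \<in> dual_space ?T \<and> \<beta> \<in> dual_space ?T \<and> \<gamma> \<in> dual_space ?T")
    case True
    obtain x where x: "\<alpha> = covector (U, \<phi>) p x" using dual_eq_covector[OF c p] True by blast
    obtain y where y: "\<beta> = covector (U, \<phi>) p y" using dual_eq_covector[OF c p] True by blast
    obtain z where z: "\<gamma> = covector (U, \<phi>) p z" using dual_eq_covector[OF c p] True by blast
    have "P p \<alpha> \<beta> \<gamma> = ?C x y z" by (simp only: components_def x y z)
    then show ?thesis unfolding x y z wedge3_covector uvw fgh(4) .
  next
    case False
    then have "P p \<alpha> \<beta> \<gamma> = 0"
      using exterior[OF pX, unfolded exterior_cube_def mem_Collect_eq, THEN conjunct1] by blast
    moreover have "wedge3 ?T u v w \<alpha> \<beta> \<gamma> = 0" unfolding wedge3_def using False by (simp only: if_False)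
    ultimately show ?thesis by simp
  qed
  then have "P p = wedge3 ?T u v w" by (intro ext)
  then show "decomposable3 ?T (P p)" using uvw(1-3) unfolding decomposable3_def by blast
qed

lemma components_differentiable:
  assumes c: "(U, \<phi>) \<in> A" and y: "y \<in> \<phi> ` U"
  shows "(\<lambda>y. components (U, \<phi>) (inv_into U \<phi> y) a b d) differentiable (at y)"
proof -
  let ?g = "(\<lambda>p. P p (differential A (\<lambda>q. a \<bullet> \<phi> q) p) (differential A (\<lambda>q. b \<bullet> \<phi> q) p)
    (differential A (\<lambda>q. d \<bullet> \<phi> q) p)) \<circ> inv_into U \<phi>"
  have "\<forall>(U, \<phi>)\<in>A. \<forall>a b c. smooth_on (\<phi> ` U)
       ((\<lambda>p. P p (differential A (\<lambda>q. a \<bullet> \<phi> q) p)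
                 (differential A (\<lambda>q. b \<bullet> \<phi> q) p)
                 (differential A (\<lambda>q. c \<bullet> \<phi> q) p)) \<circ> inv_into U \<phi>)"
    using field unfolding trivector_field_def by (elim conjE) assumption
  then have "smooth_on (\<phi> ` U) ?g" using c by blast
  then have "Ck_on (Suc 0) (\<phi> ` U) ?g" unfolding smooth_on_def by blast
  moreover have "?g y = components (U, \<phi>) (inv_into U \<phi> y) a b d" if "y \<in> \<phi> ` U" for y
  proof -
    have "inv_into U \<phi> y \<in> U" using that by (rule inv_into_into)
    then show ?thesis by (simp only: comp_apply components_def differential_coordinate[OF c])
  qed
  ultimately have "Ck_on (Suc 0) (\<phi> ` U) (\<lambda>y. components (U, \<phi>) (inv_into U \<phi> y) a b d)"
    by (rule Ck_on_cong[OF chart(2)[OF c], rotated])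
  then show ?thesis using y unfolding Ck_on.simps by blast
qed

lemma bracket3_eq_components:
  assumes c: "(U, \<phi>) \<in> A" and p: "p \<in> U"
    and "(f \<circ> inv_into U \<phi>) differentiable (at (\<phi> p))"
    and "(g \<circ> inv_into U \<phi>) differentiable (at (\<phi> p))"
    and "(h \<circ> inv_into U \<phi>) differentiable (at (\<phi> p))"
  shows "bracket3 A P f g h p = components (U, \<phi>) p (gradient E (f \<circ> inv_into U \<phi>) (\<phi> p))
    (gradient E (g \<circ> inv_into U \<phi>) (\<phi> p)) (gradient E (h \<circ> inv_into U \<phi>) (\<phi> p))"
  unfolding bracket3_def components_def by (simp only: differential_eq_covector[OF c p] assms(3-5))

text \<open>
  Expansion in the frame turns the expression into a polynomial in the coordinates of the three
  vector fields with the components of \<open>P\<close> as coefficients.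
\<close>

lemma components_along_differentiable:
  assumes c: "(U, \<phi>) \<in> A" and y0: "y0 \<in> \<phi> ` U"
    and "\<And>e. (\<lambda>y. x y \<bullet> e) differentiable (at y0)" "\<And>e. (\<lambda>y. x' y \<bullet> e) differentiable (at y0)"
      "\<And>e. (\<lambda>y. x'' y \<bullet> e) differentiable (at y0)"
  shows "(\<lambda>y. components (U, \<phi>) (inv_into U \<phi> y) (x y) (x' y) (x'' y)) differentiable (at y0)"
proof -
  let ?C = "\<lambda>y. components (U, \<phi>) (inv_into U \<phi> y)"
  have "(\<lambda>y. \<Sum>e\<in>E. (x y \<bullet> e) * (\<Sum>e'\<in>E. (x' y \<bullet> e') * (\<Sum>e''\<in>E. (x'' y \<bullet> e'') * ?C y e e' e'')))
      differentiable (at y0)"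
    by (intro differentiable_sum ballI differentiable_mult assms(3-5) components_differentiable[OF c y0]
        Parseval_frame_finite[OF frame])
  then obtain D where D: "((\<lambda>y. \<Sum>e\<in>E. (x y \<bullet> e) * (\<Sum>e'\<in>E. (x' y \<bullet> e') *
      (\<Sum>e''\<in>E. (x'' y \<bullet> e'') * ?C y e e' e''))) has_derivative D) (at y0)"
    unfolding differentiable_def by blast
  have "((\<lambda>y. ?C y (x y) (x' y) (x'' y)) has_derivative D) (at y0)"
  proof (rule has_derivative_transform_within_open[OF D chart(2)[OF c] y0])
    fix y assume "y \<in> \<phi> ` U"
    then have "inv_into U \<phi> y \<in> topspace X"
      by (rule subsetD[OF chart_subset[OF c] inv_into_into])
    note lin = alternating_trilinear_linear[OF alternating_components[OF this, of "(U, \<phi>)"]]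
    show "(\<Sum>e\<in>E. (x y \<bullet> e) * (\<Sum>e'\<in>E. (x' y \<bullet> e') * (\<Sum>e''\<in>E. (x'' y \<bullet> e'') * ?C y e e' e''))) =
        ?C y (x y) (x' y) (x'' y)"
      unfolding linear_frame_expansion[OF frame lin(1), of "x y"]
      unfolding linear_frame_expansion[OF frame lin(2), of _ "x' y"]
      unfolding linear_frame_expansion[OF frame lin(3), of _ _ "x'' y"] real_scaleR_def ..
  qed
  then show ?thesis unfolding differentiable_def by blast
qed

lemma smooth_fun_differentiable:
  assumes c: "(U, \<phi>) \<in> A" and f: "smooth_fun A f" and y: "y \<in> \<phi> ` U"
  shows "(f \<circ> inv_into U \<phi>) differentiable (at y)"
    and "(\<lambda>y. gradient E (f \<circ> inv_into U \<phi>) y \<bullet> h) differentiable (at y)"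
proof -
  let ?F = "f \<circ> inv_into U \<phi>"
  have "Ck_on (Suc (Suc 0)) (\<phi> ` U) ?F"
    using f c unfolding smooth_fun_def smooth_on_def by blast
  then have F: "?F differentiable (at y)" "(\<lambda>y. frechet_derivative ?F (at y) h) differentiable (at y)"
    if "y \<in> \<phi> ` U" for y
    using that unfolding Ck_on.simps by blast+
  show "?F differentiable (at y)" by (rule F[OF y])
  obtain D where "((\<lambda>y. frechet_derivative ?F (at y) h) has_derivative D) (at y)"
    using F(2)[OF y] unfolding differentiable_def by blast
  then have "((\<lambda>y. gradient E ?F y \<bullet> h) has_derivative D) (at y)"
    by (rule has_derivative_transform_within_open[OF _ chart(2)[OF c] y])
      (rule inner_gradient[OF frame F(1), symmetric])
  then show "(\<lambda>y. gradient E ?F y \<bullet> h) differentiable (at y)"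
    unfolding differentiable_def by blast
qed

lemma bracket3_chart:
  assumes c: "(U, \<phi>) \<in> A" and y: "y \<in> \<phi> ` U"
    and f: "smooth_fun A f" "smooth_fun A g" "smooth_fun A h"
  shows "(bracket3 A P f g h \<circ> inv_into U \<phi>) y = components (U, \<phi>) (inv_into U \<phi> y)
      (gradient E (f \<circ> inv_into U \<phi>) y) (gradient E (g \<circ> inv_into U \<phi>) y)
      (gradient E (h \<circ> inv_into U \<phi>) y)"
    and "(bracket3 A P f g h \<circ> inv_into U \<phi>) differentiable (at y)"
proof -
  let ?g = "\<lambda>f. gradient E (f \<circ> inv_into U \<phi>)"
  have eq: "(bracket3 A P f g h \<circ> inv_into U \<phi>) y =
      components (U, \<phi>) (inv_into U \<phi> y) (?g f y) (?g g y) (?g h y)" if y: "y \<in> \<phi> ` U" for y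
  proof -
    have "inv_into U \<phi> y \<in> U" "\<phi> (inv_into U \<phi> y) = y"
      using y by (auto intro: inv_into_into f_inv_into_f)
    then show ?thesis
      using bracket3_eq_components[OF c, of "inv_into U \<phi> y" f g h]
        smooth_fun_differentiable(1)[OF c f(1) y] smooth_fun_differentiable(1)[OF c f(2) y]
        smooth_fun_differentiable(1)[OF c f(3) y]
      by simp
  qed
  show "(bracket3 A P f g h \<circ> inv_into U \<phi>) y =
      components (U, \<phi>) (inv_into U \<phi> y) (?g f y) (?g g y) (?g h y)" by (rule eq[OF y])
  obtain D where "((\<lambda>y. components (U, \<phi>) (inv_into U \<phi> y) (?g f y) (?g g y) (?g h y))
      has_derivative D) (at y)"
    using components_along_differentiable[OF c y smooth_fun_differentiable(2)[OF c f(1) y]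
      smooth_fun_differentiable(2)[OF c f(2) y] smooth_fun_differentiable(2)[OF c f(3) y]]
    unfolding differentiable_def by blast
  then have "((bracket3 A P f g h \<circ> inv_into U \<phi>) has_derivative D) (at y)"
    by (rule has_derivative_transform_within_open[OF _ chart(2)[OF c] y]) (rule eq[symmetric])
  then show "(bracket3 A P f g h \<circ> inv_into U \<phi>) differentiable (at y)"
    unfolding differentiable_def by blast
qed

lemma iterated_bracket3:
  assumes c: "(U, \<phi>) \<in> A" and p: "p \<in> U" and f: "\<And>i :: nat. smooth_fun A (f i)"
  shows "bracket3 A P (bracket3 A P (f i) (f j) (f k)) (f l) (f m) p =
    components (U, \<phi>) p (gradient E (bracket3 A P (f i) (f j) (f k) \<circ> inv_into U \<phi>) (\<phi> p))
      (gradient E (f l \<circ> inv_into U \<phi>) (\<phi> p)) (gradient E (f m \<circ> inv_into U \<phi>) (\<phi> p))"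
  by (intro bracket3_eq_components[OF c p] bracket3_chart(2)[OF c] smooth_fun_differentiable(1)[OF c]
      f imageI p)

text \<open>
  A linear form applied to a gradient is a directional derivative, along the vector that represents
  the form.
\<close>

lemma linear_gradient:
  assumes "linear l" "F differentiable (at y)"
  shows "l (gradient E F y) = frechet_derivative F (at y) (\<Sum>e\<in>E. l e *\<^sub>R e)"
  using linear_functional_eq_inner[OF frame assms(1), of "gradient E F y"]
    inner_gradient[OF frame assms(2)]
  by (simp only: inner_commute)

section \<open>Decomposability and the generalized Jacobi identity\<close>

text \<open>
  The outer bracket only sees the derivatives of the inner one along the three vectors that represent
  \<open>u\<close>, \<open>v\<close>, \<open>w\<close>. Substituting \<open>T = \<kappa> (u \<and> v \<and> w)\<close> in the inner bracket before differentiating and in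
  the outer bracket afterwards puts the double bracket into the form of
  \<open>alternation5_wedge_derivative\<close>.
\<close>

lemma alternation_vanishes_of_decomposable:
  assumes c: "(U, \<phi>) \<in> A" and p: "p \<in> U" and f: "\<And>i :: nat. smooth_fun A (f i)"
    and dec: "\<And>q. q \<in> U \<Longrightarrow> decomposable3 (tangent_space A q) (P q)"
  shows "alternation5 (\<lambda>i j k l m.
    bracket3 A P (bracket3 A P (f i) (f j) (f k)) (f l) (f m) p) = 0"
proof -
  define C where "C y = components (U, \<phi>) (inv_into U \<phi> y)" for y
  define y0 where "y0 = \<phi> p"
  define g where "g i y = gradient E (f i \<circ> inv_into U \<phi>) y" for i y
  define B where "B i j k = bracket3 A P (f i) (f j) (f k) \<circ> inv_into U \<phi>" for i j k
  have y0: "y0 \<in> \<phi> ` U" using p by (simp add: y0_def)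
  have C_y0: "C y0 = components (U, \<phi>) p" using c p by (simp add: C_def y0_def)
  have inv: "inv_into U \<phi> y \<in> U" if "y \<in> \<phi> ` U" for y using that by (rule inv_into_into)
  have alt: "alternating_trilinear (C y)" if "y \<in> \<phi> ` U" for y
    unfolding C_def using inv[OF that] chart_subset[OF c] by (intro alternating_components) blast
  have rel: "contractions_decomposable (C y)" if "y \<in> \<phi> ` U" for y
    unfolding C_def using dec[OF inv[OF that]] decomposable3_iff[OF c inv[OF that]] by simp
  have outer: "bracket3 A P (bracket3 A P (f i) (f j) (f k)) (f l) (f m) p =
      C y0 (gradient E (B i j k) y0) (g l y0) (g m y0)" for i j k l m
    unfolding C_y0 unfolding B_def g_def y0_def by (rule iterated_bracket3[OF c p f])
  have B: "B i j k y = C y (g i y) (g j y) (g k y)" if "y \<in> \<phi> ` U" for i j k y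
    unfolding B_def C_def g_def by (rule bracket3_chart(1)[OF c that f f f])
  have diff_g: "(\<lambda>y. g i y \<bullet> e) differentiable (at y0)" for i e
    unfolding g_def by (rule smooth_fun_differentiable(2)[OF c f y0])
  show ?thesis
  proof (cases "\<exists>a b d. C y0 a b d \<noteq> 0")
    case False
    then show ?thesis unfolding outer by (simp add: alternation5_def)
  next
    case True
    then obtain a b d where nz: "C y0 a b d \<noteq> 0" by blast
    define \<kappa> where "\<kappa> y = inverse ((C y a b d)\<^sup>2)" for y
    define u where "u i y = C y (g i y) b d" for i y
    define v where "v i y = C y a (g i y) d" for i y
    define w where "w i y = C y a b (g i y)" for i y
    let ?D = "\<lambda>F. frechet_derivative F (at y0)"
    have diff_C: "(\<lambda>y. C y a b d) differentiable (at y0)"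
      unfolding C_def by (rule components_differentiable[OF c y0])
    have "\<kappa> differentiable (at y0)"
      unfolding \<kappa>_def using diff_C nz by (intro differentiable_inverse differentiable_power) auto
    moreover have "u i differentiable (at y0)" "v i differentiable (at y0)" "w i differentiable (at y0)" for i
      unfolding u_def v_def w_def C_def
      by (intro components_along_differentiable[OF c y0] diff_g differentiable_const)+
    ultimately have D: "(\<kappa> has_derivative ?D \<kappa>) (at y0)" "(u i has_derivative ?D (u i)) (at y0)"
      "(v i has_derivative ?D (v i)) (at y0)" "(w i has_derivative ?D (w i)) (at y0)" for i
      unfolding frechet_derivative_works by blast+
    \<comment> \<open>the neighbourhood on which \<open>a\<close>, \<open>b\<close>, \<open>d\<close> can be used to factor the form\<close>
    define S where "S = \<phi> ` U \<inter> (\<lambda>y. C y a b d) -` (- {0})"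
    have "continuous_on (\<phi> ` U) (\<lambda>y. C y a b d)"
      unfolding C_def
      by (intro differentiable_imp_continuous_on differentiable_at_imp_differentiable_on
          components_differentiable[OF c])
    then have S: "open S"
      unfolding S_def by (rule continuous_open_preimage[OF _ chart(2)[OF c]]) auto
    have y0S: "y0 \<in> S" using y0 nz by (simp add: S_def)
    have C_eq: "C y x x' x'' = \<kappa> y * wedge_forms (\<lambda>x. C y x b d) (\<lambda>x. C y a x d) (\<lambda>x. C y a b x) x x' x''"
      if "y \<in> S" for y x x' x''
    proof -
      have y: "y \<in> \<phi> ` U" "C y a b d \<noteq> 0" using that by (auto simp: S_def)
      then have "C y x x' x'' = \<kappa> y * ((C y a b d)\<^sup>2 * C y x x' x'')" by (simp add: \<kappa>_def flip: mult.assoc)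
      then show ?thesis
        by (simp only: eq_wedge_forms_of_contractions_decomposable[OF alt[OF y(1)] rel[OF y(1)] y(2)])
    qed
    define B' where "B' i j k h = ?D \<kappa> h * wedge_forms (\<lambda>i. u i y0) (\<lambda>i. v i y0) (\<lambda>i. w i y0) i j k +
      \<kappa> y0 * (wedge_forms (\<lambda>i. ?D (u i) h) (\<lambda>i. v i y0) (\<lambda>i. w i y0) i j k +
        wedge_forms (\<lambda>i. u i y0) (\<lambda>i. ?D (v i) h) (\<lambda>i. w i y0) i j k +
        wedge_forms (\<lambda>i. u i y0) (\<lambda>i. v i y0) (\<lambda>i. ?D (w i) h) i j k)" for i j k h
    have "(B i j k has_derivative B' i j k) (at y0)" for i j k
      unfolding B'_def
    proof (rule has_derivative_transform_within_open[OF has_derivative_wedge_forms[OF D] S y0S])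
      fix y assume y: "y \<in> S"
      then have "y \<in> \<phi> ` U" by (simp add: S_def)
      show "\<kappa> y * wedge_forms (\<lambda>i. u i y) (\<lambda>i. v i y) (\<lambda>i. w i y) i j k = B i j k y"
        unfolding B[OF \<open>y \<in> \<phi> ` U\<close>] C_eq[OF y, of "g i y"] by (simp add: wedge_forms_def u_def v_def w_def)
    qed
    then have B': "B i j k differentiable (at y0)" "?D (B i j k) = B' i j k" for i j k
      using frechet_derivative_at[of "B i j k" "B' i j k" y0] by (auto simp: differentiable_def)
    note lin = alternating_trilinear_linear[OF alt[OF y0]]
    define hu where "hu = (\<Sum>e\<in>E. C y0 e b d *\<^sub>R e)"
    define hv where "hv = (\<Sum>e\<in>E. C y0 a e d *\<^sub>R e)"
    define hw where "hw = (\<Sum>e\<in>E. C y0 a b e *\<^sub>R e)"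
    have grad: "C y0 (gradient E (B i j k) y0) b d = B' i j k hu"
      "C y0 a (gradient E (B i j k) y0) d = B' i j k hv"
      "C y0 a b (gradient E (B i j k) y0) = B' i j k hw" for i j k
      unfolding B'(2)[symmetric] hu_def hv_def hw_def
      by (rule linear_gradient[OF lin(1) B'(1)], rule linear_gradient[OF lin(2) B'(1)],
          rule linear_gradient[OF lin(3) B'(1)])
    have "bracket3 A P (bracket3 A P (f i) (f j) (f k)) (f l) (f m) p = \<kappa> y0 *
        (B' i j k hu * (v l y0 * w m y0 - v m y0 * w l y0) -
         B' i j k hv * (u l y0 * w m y0 - u m y0 * w l y0) +
         B' i j k hw * (u l y0 * v m y0 - u m y0 * v l y0))" for i j k l m
      unfolding outer C_eq[OF y0S, of "gradient E (B i j k) y0"] wedge_forms_def grad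
      by (simp add: u_def v_def w_def)
    moreover have "alternation5 (\<lambda>i j k l m.
        B' i j k hu * (v l y0 * w m y0 - v m y0 * w l y0) -
        B' i j k hv * (u l y0 * w m y0 - u m y0 * w l y0) +
        B' i j k hw * (u l y0 * v m y0 - u m y0 * v l y0)) = 0"
      unfolding B'_def
      by (rule alternation5_wedge_derivative[where u = "\<lambda>i. u i y0" and v = "\<lambda>i. v i y0"
            and w = "\<lambda>i. w i y0" and u' = "\<lambda>i. ?D (u i)" and v' = "\<lambda>i. ?D (v i)"
            and w' = "\<lambda>i. ?D (w i)" and \<kappa>' = "?D \<kappa>" and \<kappa> = "\<kappa> y0"])
    ultimately show ?thesis by (simp only: alternation5_cmult mult_zero_right)
  qed
qed

text \<open>
  The test functions have gradients \<open>x i\<close> at \<open>y0\<close>, with \<open>x 1 = 0\<close>. Hence a double bracket with \<open>f 1\<close>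
  in the outer position vanishes at \<open>p\<close>. With \<open>f 1\<close> in the inner position, the inner bracket is \<open>l\<close>
  times a component of \<open>T \<xi>\<close>, and since \<open>l\<close> vanishes at \<open>y0\<close> only its derivative \<open>\<xi>\<close> contributes.
\<close>

lemma contractions_decomposable_of_ternary_Poisson:
  assumes poisson: "ternary_Poisson X A P" and c: "(U, \<phi>) \<in> A" and p: "p \<in> U"
  shows "contractions_decomposable (components (U, \<phi>) p)"
  unfolding contractions_decomposable_def
proof (intro allI)
  fix \<xi> x2 x3 x4 x5 :: 'e
  define C where "C y = components (U, \<phi>) (inv_into U \<phi> y)" for y
  define y0 where "y0 = \<phi> p"
  define x where "x i = (if i = 2 then x2 else if i = 3 then x3 else if i = 4 then x4
    else if i = 5 then x5 else 0)" for i :: nat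
  define l where "l y = \<xi> \<bullet> y + (- (\<xi> \<bullet> y0))" for y
  define Q where "Q i y = (of_bool (i = 1) / 2) * (l y * l y) + x i \<bullet> y" for i :: nat and y
  have pX: "p \<in> topspace X" using chart_subset[OF c] p by blast
  have inner_Ck: "Ck_on k UNIV (\<lambda>y. z \<bullet> y)" for k and z :: 'e
    by (intro bounded_linear_imp_Ck_on bounded_linear_inner_right)
  have "Ck_on k UNIV (Q i)" for k i
    unfolding Q_def l_def by (intro Ck_on_add Ck_on_mult Ck_on_const inner_Ck open_UNIV)
  moreover obtain S where S: "open S" "y0 \<in> S" "S \<subseteq> \<phi> ` U"
    and cut: "\<And>Q :: 'e \<Rightarrow> real. (\<And>k. Ck_on k UNIV Q) \<Longrightarrow>
      \<exists>f. smooth_fun A f \<and> (\<forall>y\<in>S. (f \<circ> inv_into U \<phi>) y = Q y)"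
    unfolding y0_def by (rule cutoff[OF c p]) blast
  ultimately have "\<forall>i. \<exists>f. smooth_fun A f \<and> (\<forall>y\<in>S. (f \<circ> inv_into U \<phi>) y = Q i y)"
    by blast
  from choice[OF this] obtain f where f: "smooth_fun A (f i)"
    "\<And>y. y \<in> S \<Longrightarrow> (f i \<circ> inv_into U \<phi>) y = Q i y" for i by blast
  define g where "g i y = gradient E (f i \<circ> inv_into U \<phi>) y" for i y
  define B where "B i j k = bracket3 A P (f i) (f j) (f k) \<circ> inv_into U \<phi>" for i j k
  have y0: "y0 \<in> \<phi> ` U" using p by (simp add: y0_def)
  have C_y0: "C y0 = components (U, \<phi>) p" using c p by (simp add: C_def y0_def)
  have alt: "alternating_trilinear (C y)" if "y \<in> S" for y
    unfolding C_def using S(3) that chart_subset[OF c] inv_into_into[of y \<phi> U]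
    by (intro alternating_components) blast
  have outer: "bracket3 A P (bracket3 A P (f i) (f j) (f k)) (f r) (f s) p =
      C y0 (gradient E (B i j k) y0) (g r y0) (g s y0)" for i j k r s
    unfolding C_y0 unfolding B_def g_def y0_def by (rule iterated_bracket3[OF c p f(1)])
  have g: "g i y = (of_bool (i = 1) * l y) *\<^sub>R \<xi> + x i" if "y \<in> S" for i y
  proof -
    have "(Q i has_derivative (\<lambda>h. ((of_bool (i = 1) * l y) *\<^sub>R \<xi> + x i) \<bullet> h)) (at y)"
      unfolding Q_def l_def
      by (rule derivative_eq_intros refl)+ (simp add: algebra_simps inner_add_left)
    then have "((f i \<circ> inv_into U \<phi>) has_derivative
        (\<lambda>h. ((of_bool (i = 1) * l y) *\<^sub>R \<xi> + x i) \<bullet> h)) (at y)"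
      by (rule has_derivative_transform_within_open[OF _ S(1) that]) (rule f(2)[symmetric])
    then show ?thesis unfolding g_def by (rule gradient_eqI[OF frame])
  qed
  have l_y0: "l y0 = 0" by (simp add: l_def)
  have g_y0: "g i y0 = x i" for i unfolding g[OF S(2)] l_y0 by simp
  have B: "B i j k y = C y (g i y) (g j y) (g k y)" if "y \<in> S" for i j k y
    unfolding B_def C_def g_def using S(3) that by (intro bracket3_chart(1)[OF c _ f(1) f(1) f(1)]) blast
  define M where "M i j y = C y \<xi> (x i) (x j)" for i j y
  define N where "N i j k y = of_bool (i = 1) * M j k y - of_bool (j = 1) * M i k y +
    of_bool (k = 1) * M i j y" for i j k y
  have x_1: "x 1 = 0" by (simp add: x_def)
  have B_eq: "B i j k y = l y * N i j k y" if "1 \<in> {i, j, k}" and y: "y \<in> S" for i j k y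
  proof -
    note lin = alternating_trilinear_linear[OF alt[OF y]]
    note linear_simps = linear_add[OF lin(1)] linear_add[OF lin(2)] linear_add[OF lin(3)]
      linear_scale[OF lin(1)] linear_scale[OF lin(2)] linear_scale[OF lin(3)]
      linear_0[OF lin(1)] linear_0[OF lin(2)] linear_0[OF lin(3)]
    note rep = alternating_trilinear_repeated[OF alt[OF y]]
    note swap = alternating_trilinear_swap[OF alt[OF y]]
    have zero: "C y (x i) (x j) (x k) = 0"
      using that(1) x_1 by (auto simp: linear_simps)
    have "C y (x i) \<xi> (x k) = - M i k y" "C y (x i) (x j) \<xi> = M i j y"
      unfolding M_def using swap(1)[of \<xi> "x i" "x k"] swap(2)[of "x i" \<xi> "x j"] swap(1)[of \<xi> "x i" "x j"]
      by simp_all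
    then show ?thesis
      unfolding B[OF y] g[OF y] linear_simps rep zero N_def by (simp add: M_def algebra_simps)
  qed
  have diff_B: "B i j k differentiable (at y0)" for i j k
    unfolding B_def by (rule bracket3_chart(2)[OF c y0 f(1) f(1) f(1)])
  have grad_B: "gradient E (B i j k) y0 = N i j k y0 *\<^sub>R \<xi>" if "1 \<in> {i, j, k}" for i j k
  proof (rule gradient_eqI[OF frame])
    have "(\<lambda>y. N i j k y) differentiable (at y0)"
      unfolding N_def M_def C_def
      by (intro differentiable_add differentiable_diff differentiable_mult differentiable_const
          components_differentiable[OF c y0])
    then obtain N' where N': "(N i j k has_derivative N') (at y0)"
      unfolding differentiable_def by blast
    have l': "(l has_derivative (\<lambda>h. \<xi> \<bullet> h)) (at y0)"
      unfolding l_def by (rule derivative_eq_intros refl)+ simp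
    have "((\<lambda>y. l y * N i j k y) has_derivative (\<lambda>h. (N i j k y0 *\<^sub>R \<xi>) \<bullet> h)) (at y0)"
      by (rule has_derivative_eq_rhs[OF has_derivative_mult[OF l' N']]) (simp add: l_y0 mult.commute)
    then show "(B i j k has_derivative (\<lambda>h. (N i j k y0 *\<^sub>R \<xi>) \<bullet> h)) (at y0)"
      by (rule has_derivative_transform_within_open[OF _ S(1,2)]) (rule B_eq[OF that, symmetric])
  qed
  note lin0 = alternating_trilinear_linear[OF alt[OF S(2)]]
  have bracket: "bracket3 A P (bracket3 A P (f i) (f j) (f k)) (f r) (f s) p = N i j k y0 * M r s y0"
    if "{i, j, k, r, s} = {1..5}" for i j k r s
  proof (cases "1 \<in> {i, j, k}")
    case True
    show ?thesis unfolding outer g_y0 grad_B[OF True] M_def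
      by (simp add: linear_scale[OF lin0(1)])
  next
    case False
    have "1 \<in> {i, j, k, r, s}" unfolding that by simp
    then have "r = 1 \<or> s = 1" using False by auto
    then show ?thesis unfolding outer g_y0 M_def
      using x_1 linear_0[OF lin0(2)] linear_0[OF lin0(3)] by auto
  qed
  have anti: "M i j y0 = - M j i y0" for i j
    unfolding M_def by (rule alternating_trilinear_swap(2)[OF alt[OF S(2)]])
  have "0 = alternation5 (\<lambda>i j k r s. bracket3 A P (bracket3 A P (f i) (f j) (f k)) (f r) (f s) p)"
    using poisson f(1) pX unfolding ternary_Poisson_def alternation5_def by simp
  also have "\<dots> = alternation5 (\<lambda>i j k r s. N i j k y0 * M r s y0)"
    by (rule alternation5_cong) (rule bracket)
  also have "\<dots> = 24 * (M 2 3 y0 * M 4 5 y0 - M 2 4 y0 * M 3 5 y0 + M 2 5 y0 * M 3 4 y0)"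
    unfolding N_def by (rule alternation5_derivation[of "\<lambda>i j. M i j y0"]) (rule anti)
  finally have "M 2 3 y0 * M 4 5 y0 - M 2 4 y0 * M 3 5 y0 + M 2 5 y0 * M 3 4 y0 = 0" by simp
  then show "components (U, \<phi>) p \<xi> x2 x3 * components (U, \<phi>) p \<xi> x4 x5 -
      components (U, \<phi>) p \<xi> x2 x4 * components (U, \<phi>) p \<xi> x3 x5 +
      components (U, \<phi>) p \<xi> x2 x5 * components (U, \<phi>) p \<xi> x3 x4 = 0"
    by (simp add: M_def x_def C_y0)
qed

end

theorem theorem5:
  fixes X :: "'m topology"
    and A :: "('m, 'e::real_inner) chart set"
    and P :: "'m \<Rightarrow> (('m, 'e) chart \<Rightarrow> 'e) trivector"
  assumes "smooth_manifold X A"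
    and "trivector_field X A P"
  shows "ternary_Poisson X A P \<longleftrightarrow>
    (\<forall>x\<in>topspace X. \<exists>U. openin X U \<and> x \<in> U \<and>
       (\<forall>y\<in>U. decomposable3 (tangent_space A y) (P y)))"
proof -
  have "\<exists>B :: 'e set. finite B \<and> span B = UNIV"
    using assms(1) unfolding smooth_manifold_def by (elim conjE) assumption
  then obtain E :: "'e set" where E: "Parseval_frame E" using Parseval_frame_exists by blast
  interpret trivector_manifold X A E P by unfold_locales (fact assms E)+
  show ?thesis
  proof
    assume "ternary_Poisson X A P"
    have "decomposable3 (tangent_space A y) (P y)" if y: "y \<in> topspace X" for y
    proof -
      obtain U \<phi> where c: "(U, \<phi>) \<in> A" "y \<in> U" by (rule covered[OF y])
      show ?thesis
        unfolding decomposable3_iff[OF c]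
        by (rule contractions_decomposable_of_ternary_Poisson[OF \<open>ternary_Poisson X A P\<close> c])
    qed
    then show "\<forall>x\<in>topspace X. \<exists>U. openin X U \<and> x \<in> U \<and>
        (\<forall>y\<in>U. decomposable3 (tangent_space A y) (P y))"
      using openin_topspace by blast
  next
    assume dec: "\<forall>x\<in>topspace X. \<exists>U. openin X U \<and> x \<in> U \<and>
        (\<forall>y\<in>U. decomposable3 (tangent_space A y) (P y))"
    show "ternary_Poisson X A P"
      unfolding ternary_Poisson_def
    proof (intro allI impI ballI)
      fix f :: "nat \<Rightarrow> 'm \<Rightarrow> real" and p
      assume f: "\<forall>i\<in>{1..5}. smooth_fun A (f i)" and p: "p \<in> topspace X"
      obtain U \<phi> where c: "(U, \<phi>) \<in> A" "p \<in> U" by (rule covered[OF p])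
      \<comment> \<open>makes all functions of the family smooth without changing the five that matter\<close>
      define f' where "f' i = f (if i \<in> {1..5} then i else 1)" for i
      have "smooth_fun A (f' i)" for i using f by (simp add: f'_def)
      moreover have "decomposable3 (tangent_space A q) (P q)" if "q \<in> U" for q
        using dec chart_subset[OF c(1)] that by blast
      ultimately have "alternation5 (\<lambda>i j k l m.
          bracket3 A P (bracket3 A P (f' i) (f' j) (f' k)) (f' l) (f' m) p) = 0"
        by (rule alternation_vanishes_of_decomposable[OF c])
      also have "alternation5 (\<lambda>i j k l m.
          bracket3 A P (bracket3 A P (f' i) (f' j) (f' k)) (f' l) (f' m) p) =
        alternation5 (\<lambda>i j k l m. bracket3 A P (bracket3 A P (f i) (f j) (f k)) (f l) (f m) p)"
      proof (rule alternation5_cong)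
        fix i j k l m :: nat assume *: "{i, j, k, l, m} = {1..5}"
        have "i \<in> {1..5}" "j \<in> {1..5}" "k \<in> {1..5}" "l \<in> {1..5}" "m \<in> {1..5}"
          unfolding *[symmetric] by simp_all
        then show "bracket3 A P (bracket3 A P (f' i) (f' j) (f' k)) (f' l) (f' m) p =
            bracket3 A P (bracket3 A P (f i) (f j) (f k)) (f l) (f m) p"
          by (simp only: f'_def if_True)
      qed
      finally show "(\<Sum>\<sigma> | \<sigma> permutes {1..5}. of_int (sign \<sigma>) *
           bracket3 A P (bracket3 A P (f (\<sigma> 1)) (f (\<sigma> 2)) (f (\<sigma> 3))) (f (\<sigma> 4)) (f (\<sigma> 5)) p) = 0"
        unfolding alternation5_def .
    qed
  qed
qed

end
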